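(* There exists an absolute constant $c>0$ such that the following holds. Let $L\ge 2$ be an integer and let $A$ be a set of integers with $\overline{d}(A)>0$, and put $\beta=1/\overline{d}(A)$. Let $(a_j,b_j)_{j\ge1}$ be a sequence of couples of positive integers with $a_j\le L$, $b_j\le L$ and $\gcd(a_j,b_j)=1$ for every $j\ge1$. For $k\ge1$ let $\Gamma_k(A)$ be defined by $\Gamma_0(A)=A$ and $\Gamma_k(A)=a_k\Gamma_{k-1}(A)-b_k\Gamma_{k-1}(A)$. Let $K=\lfloor c(\log_2(\beta)+L)\rfloor$. Then: (i) there exists a positive integer $g\le L^{K+1}$ such that for every $k\ge K$ the set $\Gamma_k(A)$ is fully periodic modulo $g$, i.e. $\Gamma_k(A)+g=\Gamma_k(A)$; (ii) the set $\{A\}\cup\{\Gamma_k(A)\mid k\ge1\}$ has cardinality at most $K+g^3L^2$ (that is, $A$ is $(K+g^3L^2)$-stable with respect to the sequence of operations $X\mapsto a_jX-b_jX$).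
   Context: For $X\subset\mathbb{Z}$ and integers $a,b$, $aX-bX=\{ax-bx'\mid x,x'\in X\}$, and $X+g=\{x+g\mid x\in X\}$. The upper density of a set $A$ of integers is $\overline{d}(A)=\limsup_{n\to\infty}|A\cap\{1,\dots,n\}|/n$. $\log_2$ is the base-2 logarithm. A set $X$ is called $t$-stable with respect to the sequence of linear operations $\Gamma_{a_j,b_j}:X\mapsto a_jX-b_jX$ if the family $\{X\}\cup\{\Gamma_k(X)\mid k\ge 1\}$ (with $\Gamma_k$ the composition of the first $k$ operations, applied in the order $j=1,\dots,k$) has cardinality at most $t$. *)

theory Defs
  imports Complex_Main "HOL-Library.Extended_Real" "HOL-Library.Liminf_Limsup"
begin

text \<open>The limsup is taken in the extended reals because \<^typ>\<open>real\<close> is not a complete lattice.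
  All terms lie in the interval from 0 to 1, so the conversion back to \<^typ>\<open>real\<close> loses nothing
  (lemma \<open>ereal_upper_density\<close>). The term for \<open>n = 0\<close> is \<open>0 / 0 = 0\<close> and does not matter.\<close>

definition upper_density :: "int set \<Rightarrow> real" where
  "upper_density A =
     real_of_ereal (limsup (\<lambda>n::nat. ereal (real (card (A \<inter> {1..int n})) / real n)))"

definition lin_op :: "int \<Rightarrow> int \<Rightarrow> int set \<Rightarrow> int set" where
  "lin_op a b X = {a * x - b * x' | x x'. x \<in> X \<and> x' \<in> X}"

text \<open>The sequences of coefficients are indexed from 1; their values at 0 are never used.\<close>

primrec lin_iter :: "(nat \<Rightarrow> int) \<Rightarrow> (nat \<Rightarrow> int) \<Rightarrow> nat \<Rightarrow> int set \<Rightarrow> int set" where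
  "lin_iter a b 0 X = X"
| "lin_iter a b (Suc k) X = lin_op (a (Suc k)) (b (Suc k)) (lin_iter a b k X)"

definition translate :: "int set \<Rightarrow> int \<Rightarrow> int set" where
  "translate X g = {x + g | x. x \<in> X}"

definition fully_periodic :: "int \<Rightarrow> int set \<Rightarrow> bool" where
  "fully_periodic g X \<longleftrightarrow> translate X g = X"

text \<open>Finiteness is required explicitly since \<^const>\<open>card\<close> is 0 on infinite sets.\<close>

definition lin_stable :: "(nat \<Rightarrow> int) \<Rightarrow> (nat \<Rightarrow> int) \<Rightarrow> nat \<Rightarrow> int set \<Rightarrow> bool" where
  "lin_stable a b t X \<longleftrightarrow>
     finite ({X} \<union> {lin_iter a b k X | k. k \<ge> 1}) \<and>
     card ({X} \<union> {lin_iter a b k X | k. k \<ge> 1}) \<le> t"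

lemma density_quotient_bounds:
  "0 \<le> real (card (A \<inter> {1..int n})) / real n" "real (card (A \<inter> {1..int n})) / real n \<le> 1"
proof -
  have "card (A \<inter> {1..int n}) \<le> card {1..int n}" by (rule card_mono) auto
  hence "card (A \<inter> {1..int n}) \<le> n" by simp
  thus "real (card (A \<inter> {1..int n})) / real n \<le> 1" by (cases "n = 0") auto
qed simp

lemma ereal_upper_density:
  "ereal (upper_density A) = limsup (\<lambda>n::nat. ereal (real (card (A \<inter> {1..int n})) / real n))"
  (is "_ = ?l")
proof -
  have "?l \<le> 1"
    by (rule Limsup_bounded) (use density_quotient_bounds(2) in \<open>auto simp: one_ereal_def\<close>)
  moreover have "0 \<le> ?l"
    by (rule le_Limsup) (use density_quotient_bounds(1) in \<open>auto simp: zero_ereal_def\<close>)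
  ultimately show ?thesis
    unfolding upper_density_def by (intro ereal_real') auto
qed

lemma upper_density_bounds: "0 \<le> upper_density A" "upper_density A \<le> 1"
proof -
  have "ereal (upper_density A) \<le> ereal 1" unfolding ereal_upper_density
    by (rule Limsup_bounded) (use density_quotient_bounds(2) in \<open>auto simp: one_ereal_def\<close>)
  thus "upper_density A \<le> 1" by simp
  have "ereal 0 \<le> ereal (upper_density A)" unfolding ereal_upper_density
    by (rule le_Limsup) (use density_quotient_bounds(1) in \<open>auto simp: zero_ereal_def\<close>)
  thus "0 \<le> upper_density A" by simp
qed

end

theory Submission
  imports Defs "HOL-Library.Set_Algebras" "HOL-Number_Theory.Cong"
begin

text \<open>Periodicity. Expanding the operations gives \<open>\<Gamma>\<^sub>k\<^sub>+\<^sub>1(A)\<close> as the sum of \<open>2^k\<close> dilates \<open>c\<^sub>S B\<close> of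
  \<open>B = a\<^sub>1 A - b\<^sub>1 A\<close>. Up to sign, each \<open>c\<^sub>S\<close> is a product of \<open>k\<close> integers in \<open>[1, L]\<close>, hence depends
  only on a multiset and takes at most \<open>2 ((k + L - 1) choose k)\<close> values. Once \<open>k\<close> is a large multiple of
  \<open>log \<beta> + L\<close>, some value \<open>v\<close> is therefore taken more than \<open>\<beta> L\<^sup>2\<close> times or so. A sum of that many copies of \<open>B\<close>
  is periodic modulo \<open>a\<^sub>1 b\<^sub>1 q\<close> with \<open>q \<le> \<beta>\<close>, because a bounded sumset of \<open>A - A\<close> contains \<open>q\<int>\<close>; adding
  the remaining dilates, and applying further operations with coprime coefficients, preserves the period.

  Stability. Split the period as \<open>g = g\<^sub>1 g\<^sub>2\<close> into coprime factors such that \<open>b\<close> is a unit modulo \<open>g\<^sub>1\<close> and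
  \<open>a\<close> is a unit modulo \<open>g\<^sub>2\<close>. Comparing fibres shows that \<open>aX - bX\<close> meets at least as many classes modulo
  \<open>g\<close> as \<open>X\<close>, and that in case of equality \<open>X\<close> is a rectangle, so that \<open>aX - bX\<close> is the image of \<open>X\<close> under an
  invertible affine map. There are at most \<open>g\<close> possible sizes and at most \<open>g\<^sup>2\<close> affine images for each.\<close>

section \<open>Periodic sets\<close>

lemma lin_op_altdef: "lin_op a b X = a *o X + (- b) *o X"
proof (intro set_eqI iffI)
  fix z assume "z \<in> lin_op a b X"
  then obtain x x' where "z = a * x + (- b) * x'" "x \<in> X" "x' \<in> X" unfolding lin_op_def by auto
  thus "z \<in> a *o X + (- b) *o X" by blast
next
  fix z assume "z \<in> a *o X + (- b) *o X"
  then obtain x x' where "z = a * x - b * x'" "x \<in> X" "x' \<in> X"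
    unfolding elt_set_times_def set_plus_def by auto
  thus "z \<in> lin_op a b X" unfolding lin_op_def by blast
qed

lemma fully_periodic_iff: "fully_periodic g X \<longleftrightarrow> (\<forall>x\<in>X. x + g \<in> X \<and> x - g \<in> X)"
proof
  assume "fully_periodic g X"
  hence X: "X = {x + g | x. x \<in> X}" unfolding fully_periodic_def translate_def by simp
  show "\<forall>x\<in>X. x + g \<in> X \<and> x - g \<in> X"
  proof
    fix x assume "x \<in> X"
    have "x \<in> {x + g | x. x \<in> X}" using X \<open>x \<in> X\<close> by simp
    then obtain y where "y \<in> X" "x = y + g" by blast
    moreover have "x + g \<in> {x + g | x. x \<in> X}" using \<open>x \<in> X\<close> by blast
    ultimately show "x + g \<in> X \<and> x - g \<in> X" using X by auto
  qed
next
  assume *: "\<forall>x\<in>X. x + g \<in> X \<and> x - g \<in> X"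
  have "x \<in> {x + g | x. x \<in> X}" if "x \<in> X" for x
    using * that by (intro CollectI exI[of _ "x - g"]) auto
  with * show "fully_periodic g X" unfolding fully_periodic_def translate_def by auto
qed

lemma fully_periodic_plus:
  assumes "fully_periodic g X"
  shows "fully_periodic g (X + Y)"
  unfolding fully_periodic_iff
proof
  fix z assume "z \<in> X + Y"
  then obtain x y where z: "z = x + y" "x \<in> X" "y \<in> Y" by (rule set_plus_elim)
  hence "(x + g) + y \<in> X + Y" "(x - g) + y \<in> X + Y"
    using assms unfolding fully_periodic_iff by blast+
  thus "z + g \<in> X + Y \<and> z - g \<in> X + Y" using z by (simp add: algebra_simps)
qed

lemma fully_periodic_mult:
  assumes "fully_periodic g X"
  shows "fully_periodic (c * g) (c *o X)"
  unfolding fully_periodic_iff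
proof
  fix z assume "z \<in> c *o X"
  then obtain x where z: "z = c * x" "x \<in> X" unfolding elt_set_times_def by auto
  hence "c * (x + g) \<in> c *o X" "c * (x - g) \<in> c *o X"
    using assms unfolding fully_periodic_iff by blast+
  thus "z + c * g \<in> c *o X \<and> z - c * g \<in> c *o X" by (simp add: z algebra_simps)
qed

lemma fully_periodic_uminus: "fully_periodic (- g) X \<longleftrightarrow> fully_periodic g X"
  unfolding fully_periodic_iff by auto

lemma fully_periodic_add_mult:
  assumes "fully_periodic g X" "x \<in> X"
  shows "x + g * t \<in> X"
proof (induction t rule: int_induct[where k = 0])
  case base show ?case using assms by simp
next
  case (step1 i)
  thus ?case using assms(1) unfolding fully_periodic_iff by (auto simp: algebra_simps)
next
  case (step2 i)
  thus ?case using assms(1) unfolding fully_periodic_iff by (auto simp: algebra_simps)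
qed

lemma fully_periodic_cong:
  assumes "fully_periodic g X" "x \<in> X" "[x = y] (mod g)"
  shows "y \<in> X"
proof -
  obtain t where "y = x + g * t" using assms(3) by (metis cong_iff_lin)
  thus ?thesis using fully_periodic_add_mult[OF assms(1,2)] by simp
qed

text \<open>By Bezout, \<open>u * a + v * b = 1\<close>. Moving \<open>x\<close> by
  \<open>g * u\<close> and \<open>x'\<close> by \<open>- g * v\<close> keeps both in
  \<open>X\<close> and changes \<open>a * x - b * x'\<close> by exactly \<open>g\<close>.\<close>

lemma fully_periodic_lin_op:
  assumes "fully_periodic g X" "coprime a b"
  shows "fully_periodic g (lin_op a b X)"
  unfolding fully_periodic_iff
proof
  fix z assume "z \<in> lin_op a b X"
  then obtain x x' where z: "z = a * x - b * x'" "x \<in> X" "x' \<in> X" unfolding lin_op_def by auto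
  obtain u v where uv: "u * a + v * b = 1" using assms(2) by (metis bezout_int coprime_iff_gcd_eq_1)
  have shift: "a * (x + g * (u * s)) - b * (x' + g * (- v * s)) = z + g * s" for s
  proof -
    have "a * (x + g * (u * s)) - b * (x' + g * (- v * s)) = z + g * s * (u * a + v * b)"
      by (simp add: z algebra_simps)
    thus ?thesis by (simp add: uv)
  qed
  have "z + g * s \<in> lin_op a b X" for s
    unfolding lin_op_def shift[symmetric, of s]
    using fully_periodic_add_mult[OF assms(1) z(2), of "u * s"]
      fully_periodic_add_mult[OF assms(1) z(3), of "- v * s"] by blast
  from this[of 1] this[of "-1"] show "z + g \<in> lin_op a b X \<and> z - g \<in> lin_op a b X" by simp
qed

section \<open>Iterated sumsets\<close>

definition nsum :: "nat \<Rightarrow> int set \<Rightarrow> int set" where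
  "nsum n B = (\<Sum>i<n. B)"

lemma nsum_0 [simp]: "nsum 0 B = {0}" by (simp add: nsum_def)

lemma nsum_Suc: "nsum (Suc n) B = nsum n B + B" by (simp add: nsum_def)

lemma nsum_add: "nsum (m + n) B = nsum m B + nsum n B"
  by (induction n) (simp_all add: nsum_Suc add.assoc flip: set_zero)

lemma sum_const_set:
  fixes B :: "int set"
  assumes "finite I"
  shows "(\<Sum>i\<in>I. B) = nsum (card I) B"
  using assms by (induction I) (simp_all add: nsum_Suc add.commute flip: set_zero)

lemma nsum_mono:
  assumes "0 \<in> B" "m \<le> n"
  shows "nsum m B \<subseteq> nsum n B"
proof (rule lift_Suc_mono_le[OF _ assms(2)])
  show "nsum n B \<subseteq> nsum (Suc n) B" for n
    using set_zero_plus2[OF assms(1), of "nsum n B"] unfolding nsum_Suc by (simp add: add.commute)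
qed

lemma nsum_plus_const: "nsum n (e +o B) = (int n * e) +o nsum n B"
proof (induction n)
  case 0 thus ?case by (simp add: elt_set_plus_def)
next
  case (Suc n)
  have "nsum (Suc n) (e +o B) = (int n * e + e) +o (nsum n B + B)"
    using Suc by (simp add: nsum_Suc set_plus_rearrange)
  thus ?case by (simp add: nsum_Suc algebra_simps)
qed

lemma mult_in_nsum: "x \<in> B \<Longrightarrow> int n * x \<in> nsum n B"
proof (induction n)
  case (Suc n)
  hence "int n * x + x \<in> nsum n B + B" by blast
  thus ?case by (simp add: nsum_Suc algebra_simps)
qed simp

lemma nsum_mult: "nsum m (nsum n B) = nsum (m * n) B"
  by (induction m) (simp_all add: nsum_Suc nsum_add add.commute)

lemma nsum_subset: "B \<subseteq> C \<Longrightarrow> nsum n B \<subseteq> nsum n C"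
  by (induction n) (simp_all add: nsum_Suc set_plus_mono2)

lemma nsum_times: "nsum n (c *o B) = c *o nsum n B"
  by (induction n) (auto simp: nsum_Suc set_times_plus_distrib2 elt_set_times_def[of _ "{0}"])

lemma chain_constant:
  fixes F :: "nat \<Rightarrow> 'a"
  assumes step: "\<And>n. F (Suc n) = F n \<Longrightarrow> F (Suc (Suc n)) = F (Suc n)"
    and "F (Suc i) = F i" "i \<le> j"
  shows "F j = F i"
proof -
  have "F (Suc j) = F j \<and> F j = F i"
    using assms(3) by (induction j rule: dec_induct) (use assms(2) step in auto)
  thus ?thesis ..
qed

text \<open>Strict growth at every index up to \<open>Q\<close> would give \<open>F (Suc Q)\<close>
  more than \<open>Q\<close> elements. So some step up to \<open>Q\<close> is stationary, and from
  there on the chain is frozen.\<close>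

lemma chain_stabilises:
  fixes F :: "nat \<Rightarrow> 'a set"
  assumes mono: "\<And>n. F n \<subseteq> F (Suc n)" and fin: "\<And>n. finite (F n)" and card: "\<And>n. card (F n) \<le> Q"
    and step: "\<And>n. F (Suc n) = F n \<Longrightarrow> F (Suc (Suc n)) = F (Suc n)" and "Q \<le> n"
  shows "F n = F Q"
proof -
  have "\<exists>i\<le>Q. F (Suc i) = F i"
  proof (rule ccontr)
    assume "\<not> ?thesis"
    hence *: "F i \<subset> F (Suc i)" if "i \<le> Q" for i using mono[of i] that by blast
    have "i \<le> Suc Q \<Longrightarrow> i \<le> card (F i)" for i
    proof (induction i)
      case (Suc i)
      thus ?case using psubset_card_mono[OF fin *[of i]] by simp
    qed simp
    from this[of "Suc Q"] card[of "Suc Q"] show False by simp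
  qed
  then obtain i where "i \<le> Q" "F (Suc i) = F i" by blast
  thus ?thesis using chain_constant[of F, OF step] assms(5) by (metis order_trans)
qed

text \<open>The residues modulo \<open>q\<close> met by the sumsets of \<open>B\<close> form an
  increasing chain that is frozen from level \<open>q\<close> on. An element of the
  \<open>n\<close>-fold sumset is therefore congruent to one using only \<open>n - N\<close>
  summands, and the other \<open>N\<close> summands supply any multiple of \<open>q\<close>.\<close>

lemma fully_periodic_nsum:
  assumes "0 \<in> B" "0 < q" "\<And>t. t * int q \<in> nsum N B" "N + q \<le> n"
  shows "fully_periodic (int q) (nsum n B)"
proof -
  define R where "R i = (\<lambda>x. x mod int q) ` nsum i B" for i
  \<comment> \<open>\<open>R (Suc i)\<close> depends on \<open>nsum i B\<close> only through
    \<open>R i\<close>, so one repetition freezes the chain.\<close>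
  have R_Suc: "R (Suc i) = (\<lambda>(r, b). (r + b) mod int q) ` (R i \<times> B)" for i
  proof -
    have "R (Suc i) = (\<lambda>(x, b). (x mod int q + b) mod int q) ` (nsum i B \<times> B)"
      unfolding R_def nsum_Suc set_plus_image by (auto simp: image_image split_def mod_add_left_eq)
    also have "\<dots> = (\<lambda>(r, b). (r + b) mod int q) ` (map_prod (\<lambda>x. x mod int q) id ` (nsum i B \<times> B))"
      by (simp only: image_image split_def map_prod_def id_def fst_conv snd_conv)
    also have "map_prod (\<lambda>x. x mod int q) id ` (nsum i B \<times> B) = R i \<times> B"
      unfolding R_def by (simp add: map_prod_surj_on)
    finally show ?thesis .
  qed
  have sub: "R i \<subseteq> {0..<int q}" for i unfolding R_def using assms(2) by auto
  have "R i = R q" if "q \<le> i" for i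
  proof (rule chain_stabilises[OF _ _ _ _ that])
    show "R n \<subseteq> R (Suc n)" for n unfolding R_def using nsum_mono[OF assms(1), of n "Suc n"] by auto
    show "finite (R n)" for n using sub finite_subset by blast
    show "card (R n) \<le> q" for n using card_mono[OF _ sub[of n]] by simp
    show "R (Suc n) = R n \<Longrightarrow> R (Suc (Suc n)) = R (Suc n)" for n
      by (subst R_Suc, subst (2) R_Suc) simp
  qed
  \<comment> \<open>Both \<open>n\<close> and \<open>n - N\<close> are at least
    \<open>q\<close>.\<close>
  from this[of n] this[of "n - N"] have R_eq: "R n = R (n - N)" using assms(4) by simp
  have "x + s * int q \<in> nsum n B" if "x \<in> nsum n B" for x s
  proof -
    have "x mod int q \<in> R (n - N)" using that R_eq unfolding R_def by auto
    then obtain y where y: "y \<in> nsum (n - N) B" "x mod int q = y mod int q" unfolding R_def by auto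
    then obtain t where t: "x = y + t * int q"
      by (metis add.commute diff_add_cancel dvdE mod_eq_dvd_iff mult.commute)
    have "y + (t + s) * int q \<in> nsum (n - N) B + nsum N B" using y assms(3) by blast
    also have "nsum (n - N) B + nsum N B = nsum n B" using assms(4) by (simp flip: nsum_add)
    finally show ?thesis by (simp add: t algebra_simps)
  qed
  from this[of _ 1] this[of _ "-1"] show ?thesis unfolding fully_periodic_iff by simp
qed

section \<open>Density, disjoint translates and the difference set\<close>

lemma card_disjoint_translates:
  assumes "finite T" and disj: "\<And>s t. s \<in> T \<Longrightarrow> t \<in> T \<Longrightarrow> s \<noteq> t \<Longrightarrow> (s +o A) \<inter> (t +o A) = {}"
  shows "real (card T) * upper_density A \<le> 1"
proof (cases "T = {}")
  case False
  define m where "m = card T"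
  have "m > 0" using False assms(1) by (simp add: m_def card_gt_0_iff)
  obtain M :: nat where M: "\<And>t. t \<in> T \<Longrightarrow> \<bar>t\<bar> \<le> int M"
  proof -
    have "\<exists>M. \<forall>t\<in>T. \<bar>t\<bar> \<le> int M"
      using finite_nat_set_iff_bounded_le[of "(\<lambda>t. nat \<bar>t\<bar>) ` T"] assms(1)
      by (metis (no_types, lifting) finite_imageI imageI nat_le_iff)
    thus ?thesis using that by blast
  qed
  \<comment> \<open>The \<open>m\<close> disjoint translates of \<open>A \<inter> {1..int n}\<close>
    are shifted by at most \<open>M\<close>, so all of them fit into an interval with
    \<open>n + 2 * M\<close> elements. Dividing by \<open>m * n\<close> and letting \<open>n\<close>
    grow makes the boundary term vanish.\<close>
  have bound: "m * card (A \<inter> {1..int n}) \<le> n + 2 * M" for n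
  proof -
    have "m * card (A \<inter> {1..int n}) = (\<Sum>t\<in>T. card (t +o (A \<inter> {1..int n})))"
    proof -
      have "card (t +o (A \<inter> {1..int n})) = card (A \<inter> {1..int n})" for t
      proof -
        have "t +o (A \<inter> {1..int n}) = (\<lambda>x. t + x) ` (A \<inter> {1..int n})"
          unfolding elt_set_plus_def by auto
        thus ?thesis by (simp add: card_image)
      qed
      thus ?thesis by (simp add: m_def)
    qed
    also have "\<dots> = card (\<Union>t\<in>T. t +o (A \<inter> {1..int n}))"
    proof (rule card_UN_disjoint[symmetric])
      show "\<forall>t\<in>T. finite (t +o (A \<inter> {1..int n}))" by (auto simp: elt_set_plus_def)
      show "\<forall>i\<in>T. \<forall>j\<in>T. i \<noteq> j \<longrightarrow> (i +o (A \<inter> {1..int n})) \<inter> (j +o (A \<inter> {1..int n})) = {}"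
        using disj set_plus_mono[of "A \<inter> {1..int n}" A] by blast
    qed fact
    also have "\<dots> \<le> card {1 - int M..int n + int M}"
    proof (rule card_mono)
      show "(\<Union>t\<in>T. t +o (A \<inter> {1..int n})) \<subseteq> {1 - int M..int n + int M}"
      proof
        fix z assume "z \<in> (\<Union>t\<in>T. t +o (A \<inter> {1..int n}))"
        then obtain t x where "t \<in> T" "z = t + x" "1 \<le> x" "x \<le> int n"
          unfolding elt_set_plus_def by auto
        thus "z \<in> {1 - int M..int n + int M}" using M[of t] by auto
      qed
    qed simp
    finally show ?thesis by simp
  qed
  have lim: "(\<lambda>n. ereal ((real n + 2 * real M) / (real m * real n))) \<longlonglongrightarrow> ereal (1 / real m)"
  proof (rule tendsto_ereal)
    have "(\<lambda>n. 1 / real m + (2 * real M / real m) * (1 / real n)) \<longlonglongrightarrow> 1 / real m + (2 * real M / real m) * 0"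
      by (intro tendsto_intros lim_1_over_n)
    moreover have "\<forall>\<^sub>F n in sequentially. 1 / real m + (2 * real M / real m) * (1 / real n)
       = (real n + 2 * real M) / (real m * real n)"
      using eventually_gt_at_top[of 0] by eventually_elim (use \<open>m > 0\<close> in \<open>simp add: field_simps\<close>)
    ultimately show "(\<lambda>n. (real n + 2 * real M) / (real m * real n)) \<longlonglongrightarrow> 1 / real m"
      using tendsto_cong by fastforce
  qed
  have "ereal (upper_density A) \<le> limsup (\<lambda>n. ereal ((real n + 2 * real M) / (real m * real n)))"
    unfolding ereal_upper_density
  proof (rule Limsup_mono, rule eventually_mono[OF eventually_gt_at_top[of 0]])
    fix n :: nat assume "0 < n"
    have "real m * real (card (A \<inter> {1..int n})) \<le> real n + 2 * real M"
      using bound[of n] by (simp flip: of_nat_mult of_nat_add)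
    thus "ereal (real (card (A \<inter> {1..int n})) / real n) \<le> ereal ((real n + 2 * real M) / (real m * real n))"
      using \<open>0 < n\<close> \<open>m > 0\<close> by (simp add: field_simps)
  qed
  also have "\<dots> = ereal (1 / real m)" using lim_imp_Limsup[OF _ lim] by simp
  finally show ?thesis using \<open>m > 0\<close> by (simp add: m_def[symmetric] field_simps)
qed simp

definition diffs :: "int set \<Rightarrow> int set" where
  "diffs A = {x - y | x y. x \<in> A \<and> y \<in> A}"

lemma translates_disjoint: "s - t \<notin> diffs A \<Longrightarrow> (t +o A) \<inter> (s +o A) = {}"
proof (rule ccontr)
  assume "s - t \<notin> diffs A" "(t +o A) \<inter> (s +o A) \<noteq> {}"
  then obtain x y where "x \<in> A" "y \<in> A" "t + x = s + y" unfolding elt_set_plus_def by auto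
  hence "s - t = x - y" by simp
  thus False using \<open>x \<in> A\<close> \<open>y \<in> A\<close> \<open>s - t \<notin> diffs A\<close> unfolding diffs_def by blast
qed

lemma uminus_diffs: "x \<in> diffs A \<Longrightarrow> - x \<in> diffs A"
  unfolding diffs_def by force

text \<open>The translates of \<open>A\<close> by \<open>0, ..., m\<close> are more than
  \<open>1 / upper_density A\<close> in number, so two of them meet, and the difference of the two
  shifts lies in \<open>A - A\<close>.\<close>

lemma ex_small_difference:
  assumes "upper_density A > 0"
  obtains q where "0 < q" "int q \<in> diffs A" "q \<le> nat \<lfloor>1 / upper_density A\<rfloor>"
proof -
  define m where "m = nat \<lfloor>1 / upper_density A\<rfloor>"
  have "\<exists>i\<le>m. \<exists>j<i. int i - int j \<in> diffs A"
  proof (rule ccontr)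
    assume *: "\<not> ?thesis"
    have "real (card (int ` {..m})) * upper_density A \<le> 1"
    proof (rule card_disjoint_translates)
      fix s t assume "s \<in> int ` {..m}" "t \<in> int ` {..m}" "s \<noteq> t"
      then obtain i j where "s = int i" "t = int j" "i \<le> m" "j \<le> m" "i \<noteq> j" by auto
      hence "s - t \<notin> diffs A" "t - s \<notin> diffs A"
        using * uminus_diffs[of "s - t" A] uminus_diffs[of "t - s" A]
        by (metis linorder_neqE_nat minus_diff_eq)+
      thus "(s +o A) \<inter> (t +o A) = {}" using translates_disjoint by blast
    qed simp
    hence "real m + 1 \<le> 1 / upper_density A"
      using assms by (simp add: card_image field_simps)
    moreover have "1 / upper_density A < real m + 1"
      using assms unfolding m_def by simp
    ultimately show False by simp
  qed
  then obtain i j where "i \<le> m" "j < i" "int i - int j \<in> diffs A" by blast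
  thus ?thesis using that[of "i - j"] by (auto simp: m_def)
qed

text \<open>If the chain \<open>nsum n D\<close> grows strictly up to \<open>2 m\<close>, then new elements picked at every second
  level are pairwise non-adjacent in the Cayley graph of \<open>D = A - A\<close>, so they give \<open>m + 1\<close> disjoint
  translates of \<open>A\<close>.\<close>

lemma nsum_diffs_stabilises:
  assumes "upper_density A > 0" "A \<noteq> {}"
  shows "nsum n (diffs A) \<subseteq> nsum (2 * nat \<lfloor>1 / upper_density A\<rfloor>) (diffs A)"
proof -
  define D where "D = diffs A"
  define m where "m = nat \<lfloor>1 / upper_density A\<rfloor>"
  have "0 \<in> D" using assms(2) unfolding D_def diffs_def by force
  have "\<exists>i\<le>2 * m. nsum (Suc i) D = nsum i D"
  proof (rule ccontr)
    assume *: "\<not> ?thesis"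
    have "\<exists>y. y \<in> nsum (2 * i) D \<and> (\<forall>j<i. y \<notin> nsum (Suc (2 * j)) D)" if "i \<le> m" for i
    proof (cases "i = 0")
      case True thus ?thesis using \<open>0 \<in> D\<close> by auto
    next
      case False
      hence "2 * i - 1 \<le> 2 * m" "Suc (2 * i - 1) = 2 * i" using that by auto
      hence "nsum (2 * i) D \<noteq> nsum (2 * i - 1) D" using * by metis
      hence "nsum (2 * i - 1) D \<subset> nsum (2 * i) D"
        using * that
          nsum_mono[OF \<open>0 \<in> D\<close>, of "2 * i - 1" "2 * i"]
        by auto
      then obtain y where y: "y \<in> nsum (2 * i) D" "y \<notin> nsum (2 * i - 1) D" by auto
      have "nsum (Suc (2 * j)) D \<subseteq> nsum (2 * i - 1) D" if "j < i" for j
        using nsum_mono[OF \<open>0 \<in> D\<close>, of "Suc (2 * j)" "2 * i - 1"] that by simp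
      thus ?thesis using y by auto
    qed
    then obtain y where y: "\<And>i. i \<le> m \<Longrightarrow> y i \<in> nsum (2 * i) D"
      and y': "\<And>i j. i \<le> m \<Longrightarrow> j < i \<Longrightarrow> y i \<notin> nsum (Suc (2 * j)) D" by metis
    \<comment> \<open>Otherwise \<open>y i\<close> would be reached from \<open>y j\<close> by one
      more summand, hence lie on level \<open>2 * j + 1\<close>, which its choice excludes.\<close>
    have far: "y i - y j \<notin> D" if "j < i" "i \<le> m" for i j
    proof
      assume "y i - y j \<in> D"
      hence "y j + (y i - y j) \<in> nsum (Suc (2 * j)) D"
        unfolding nsum_Suc using y[of j] that by (intro set_plus_intro) auto
      thus False using y'[of i j] that by simp
    qed
    have inj: "inj_on y {..m}"
      by (rule linorder_inj_onI) (use far \<open>0 \<in> D\<close> in fastforce)+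
    have "real (card (y ` {..m})) * upper_density A \<le> 1"
    proof (rule card_disjoint_translates)
      fix s t assume "s \<in> y ` {..m}" "t \<in> y ` {..m}" "s \<noteq> t"
      then obtain i j where "s = y i" "t = y j" "i \<le> m" "j \<le> m" "i \<noteq> j" by auto
      hence "s - t \<notin> diffs A" "t - s \<notin> diffs A"
        using far[of i j] far[of j i] uminus_diffs[of "s - t" A] uminus_diffs[of "t - s" A]
        unfolding D_def by (metis linorder_neqE_nat minus_diff_eq)+
      thus "(s +o A) \<inter> (t +o A) = {}" using translates_disjoint by blast
    qed simp
    hence "real m + 1 \<le> 1 / upper_density A"
      using assms inj by (simp add: card_image field_simps)
    moreover have "1 / upper_density A < real m + 1"
      using assms unfolding m_def by simp
    ultimately show False by simp
  qed
  then obtain i where "i \<le> 2 * m" "nsum (Suc i) D = nsum i D" by blast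
  hence const: "nsum j D = nsum i D" if "i \<le> j" for j
    using chain_constant[of "\<lambda>n. nsum n D" i j] that by (simp add: nsum_Suc)
  show ?thesis
  proof (cases "i \<le> n")
    case True thus ?thesis using const[of n] const[OF \<open>i \<le> 2 * m\<close>] by (simp add: D_def m_def)
  next
    case False thus ?thesis
      using nsum_mono[OF \<open>0 \<in> D\<close>, of n "2 * m"] \<open>i \<le> 2 * m\<close> by (simp add: D_def m_def)
  qed
qed

lemma fully_periodic_plus_const: "fully_periodic g X \<Longrightarrow> fully_periodic g (e +o X)"
  using fully_periodic_plus[of g X "{e}"] by (simp add: elt_set_plus_def set_plus_def add.commute)

text \<open>After translating \<open>A\<close> so that it contains 0, \<open>B\<close> contains
  \<open>a x\<close> and \<open>- b y\<close> separately. Then \<open>b\<close> copies of the former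
  and \<open>a\<close> copies of the latter add up to \<open>a b (x - y)\<close>, so
  \<open>M * (a + b)\<close> copies of \<open>B\<close> cover \<open>a b\<close> times the
  \<open>M\<close>-fold sumset of \<open>A - A\<close>, which contains all multiples of
  \<open>q\<close>.\<close>

lemma fully_periodic_nsum_lin_op:
  fixes a b q n :: nat
  assumes dens: "upper_density A > 0" and pos: "0 < a" "0 < b" "0 < q"
    and q: "int q \<in> diffs A"
    and n: "2 * nat \<lfloor>1 / upper_density A\<rfloor> * (a + b) + a * b * q \<le> n"
  shows "fully_periodic (int (a * b * q)) (nsum n (lin_op (int a) (int b) A))"
proof -
  define M where "M = 2 * nat \<lfloor>1 / upper_density A\<rfloor>"
  obtain z where "z \<in> A" using q unfolding diffs_def by auto
  define A' where "A' = (- z) +o A"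
  define B where "B = lin_op (int a) (int b) A'"
  have "0 \<in> A'" using \<open>z \<in> A\<close> unfolding A'_def elt_set_plus_def by force
  hence B: "int a * x - int b * y \<in> B" if "x \<in> A'" "y \<in> A'" for x y
    using that unfolding B_def lin_op_def by blast
  have "0 \<in> B" using B[OF \<open>0 \<in> A'\<close> \<open>0 \<in> A'\<close>] by simp
  have "(int a * int b) *o diffs A \<subseteq> nsum (a + b) B"
  proof
    fix w assume "w \<in> (int a * int b) *o diffs A"
    then obtain x y where w: "w = int a * int b * (x - y)" "x \<in> A" "y \<in> A"
      unfolding diffs_def elt_set_times_def by auto
    have "x - z \<in> A'" "y - z \<in> A'" using w unfolding A'_def elt_set_plus_def by force+
    from B[OF this(1) \<open>0 \<in> A'\<close>] B[OF \<open>0 \<in> A'\<close> this(2)]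
    have "int b * (int a * (x - z)) \<in> nsum b B" "int a * (- (int b * (y - z))) \<in> nsum a B"
      using mult_in_nsum[of "int a * (x - z)" B b] mult_in_nsum[of "- (int b * (y - z))" B a]
      by auto
    hence "int a * (- (int b * (y - z))) + int b * (int a * (x - z)) \<in> nsum (a + b) B"
      unfolding nsum_add by blast
    thus "w \<in> nsum (a + b) B" by (simp add: w algebra_simps)
  qed
  from nsum_subset[OF this, of M]
  have sub: "(int a * int b) *o nsum M (diffs A) \<subseteq> nsum (M * (a + b)) B"
    by (simp add: nsum_times nsum_mult)
  \<comment> \<open>A multiple of \<open>q\<close> may take many summands, but the sumsets of
    \<open>A - A\<close> stop growing at level \<open>M\<close>.\<close>
  have "t * int q \<in> nsum M (diffs A)" for t
  proof -
    have "t * int q \<in> nsum (nat \<bar>t\<bar>) (diffs A)"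
      using mult_in_nsum[OF q, of "nat \<bar>t\<bar>"] mult_in_nsum[OF uminus_diffs[OF q], of "nat \<bar>t\<bar>"]
      by (cases "t \<ge> 0") auto
    thus ?thesis using nsum_diffs_stabilises[OF dens, of "nat \<bar>t\<bar>"] \<open>z \<in> A\<close> unfolding M_def by blast
  qed
  hence "int a * int b * (t * int q) \<in> nsum (M * (a + b)) B" for t using sub by blast
  hence "t * int (a * b * q) \<in> nsum (M * (a + b)) B" for t by (simp add: mult.left_commute mult.assoc)
  hence "fully_periodic (int (a * b * q)) (nsum n B)"
    using n pos by (intro fully_periodic_nsum[OF \<open>0 \<in> B\<close>, of _ "M * (a + b)"]) (auto simp: M_def)
  \<comment> \<open>Undoing the normalising translation only translates \<open>B\<close>, hence also
    its \<open>n\<close>-fold sumset.\<close>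
  moreover have "lin_op (int a) (int b) A = ((int a - int b) * z) +o B"
  proof -
    have "A = z +o A'" unfolding A'_def by (simp add: set_plus_rearrange2)
    thus ?thesis unfolding B_def lin_op_altdef
      by (simp add: set_times_plus_distrib set_plus_rearrange algebra_simps)
  qed
  ultimately show ?thesis by (simp add: nsum_plus_const fully_periodic_plus_const)
qed

section \<open>Popular coefficients\<close>

text \<open>\<open>S\<close> is the set of steps at which the summand with \<open>a j\<close> is
  chosen when the iterated operation is expanded.\<close>

definition coeff :: "(nat \<Rightarrow> int) \<Rightarrow> (nat \<Rightarrow> int) \<Rightarrow> nat \<Rightarrow> nat set \<Rightarrow> int" where
  "coeff a b k S = (\<Prod>j\<in>{1..k}. if j \<in> S then a j else - b j)"

lemma elt_set_times_sum:
  fixes X :: "'i \<Rightarrow> int set"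
  assumes "finite I"
  shows "c *o (\<Sum>i\<in>I. X i) = (\<Sum>i\<in>I. c *o X i)"
  using assms by (induction I) (simp_all add: set_times_plus_distrib2 elt_set_times_def[of _ "{0}"])

text \<open>Dilation distributes over sumsets, so step \<open>Suc k\<close> splits each dilate into
  two, according to whether \<open>Suc k\<close> belongs to \<open>S\<close>. The sum runs over sets
  and not over coefficient values, because equal dilates must be kept apart: \<open>B + B\<close> is
  in general larger than \<open>2 *o B\<close>.\<close>

lemma lin_iter_eq_sum: "lin_iter a b k B = (\<Sum>S\<in>Pow {1..k}. coeff a b k S *o B)"
proof (induction k)
  case 0 thus ?case by (simp add: coeff_def flip: set_zero)
next
  case (Suc k)
  have Pow: "Pow {1..Suc k} = Pow {1..k} \<union> insert (Suc k) ` Pow {1..k}"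
    by (simp add: atLeastAtMostSuc_conv Pow_insert)
  have inj: "inj_on (insert (Suc k)) (Pow {1..k})"
  proof (rule inj_onI)
    fix S T assume "S \<in> Pow {1..k}" "T \<in> Pow {1..k}" "insert (Suc k) S = insert (Suc k) T"
    moreover from this have "Suc k \<notin> S" "Suc k \<notin> T" by auto
    ultimately show "S = T" by (simp add: insert_ident)
  qed
  have disj: "Pow {1..k} \<inter> insert (Suc k) ` Pow {1..k} = {}" by auto
  have c1: "coeff a b (Suc k) S = - b (Suc k) * coeff a b k S"
    and c2: "coeff a b (Suc k) (insert (Suc k) S) = a (Suc k) * coeff a b k S"
    if "S \<in> Pow {1..k}" for S
  proof -
    have "Suc k \<notin> S" using that by auto
    thus "coeff a b (Suc k) S = - b (Suc k) * coeff a b k S"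
      unfolding coeff_def by (simp add: mult.commute)
    have "(\<Prod>j\<in>{1..k}. if j \<in> insert (Suc k) S then a j else - b j)
        = (\<Prod>j\<in>{1..k}. if j \<in> S then a j else - b j)" by (rule prod.cong) auto
    thus "coeff a b (Suc k) (insert (Suc k) S) = a (Suc k) * coeff a b k S"
      unfolding coeff_def by (simp add: mult.commute)
  qed
  have "(\<Sum>S\<in>Pow {1..Suc k}. coeff a b (Suc k) S *o B)
      = (\<Sum>S\<in>Pow {1..k}. coeff a b (Suc k) S *o B)
        + (\<Sum>S\<in>Pow {1..k}. coeff a b (Suc k) (insert (Suc k) S) *o B)"
    unfolding Pow by (subst sum.union_disjoint) (use disj inj in \<open>simp_all add: sum.reindex\<close>)
  also have "\<dots> = (\<Sum>S\<in>Pow {1..k}. (- b (Suc k)) *o (coeff a b k S *o B))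
        + (\<Sum>S\<in>Pow {1..k}. a (Suc k) *o (coeff a b k S *o B))"
    unfolding set_times_rearrange2 by (simp add: c1 c2)
  also have "\<dots> = lin_iter a b (Suc k) B"
    by (simp add: lin_op_altdef Suc elt_set_times_sum add.commute)
  finally show ?case ..
qed

text \<open>The product depends only on how often each value from \<open>1\<close> to
  \<open>L\<close> occurs. These multiplicities form a list of \<open>L\<close> naturals with sum
  \<open>k\<close>, and stars and bars counts such lists.\<close>

lemma card_bounded_products:
  fixes k L :: nat
  defines "P \<equiv> {\<Prod>j\<in>{1..k}. h j | h. \<forall>j\<in>{1..k}. 1 \<le> h j \<and> h j \<le> L}"
  shows "finite P" and "card P \<le> (k + L - 1) choose k"
proof -
  \<comment> \<open>\<open>F\<close> rebuilds the product from the multiplicities; that of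
    \<open>v\<close> stands at position \<open>v - 1\<close>, as lists are indexed from 0.\<close>
  define F where "F l = (\<Prod>v\<in>{1..L}. v ^ (l ! (v - 1)))" for l :: "nat list"
  define W where "W = {l :: nat list. length l = L \<and> sum_list l = k}"
  have "W \<subseteq> {l. set l \<subseteq> {..k} \<and> length l = L}"
    unfolding W_def by (auto simp: member_le_sum_list)
  hence "finite W" by (rule finite_subset) (simp add: finite_lists_length_eq)
  have sub: "P \<subseteq> F ` W"
  proof
    fix x assume "x \<in> P"
    then obtain h where h: "\<forall>j\<in>{1..k}. 1 \<le> h j \<and> h j \<le> L" and x: "x = (\<Prod>j\<in>{1..k}. h j)"
      unfolding P_def by auto
    define cnt where "cnt v = card {j \<in> {1..k}. h j = v}" for v
    define l where "l = map cnt [1..<Suc L]"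
    have img: "h ` {1..k} \<subseteq> {1..L}" using h by auto
    have "x = (\<Prod>v\<in>{1..L}. \<Prod>j\<in>{j \<in> {1..k}. h j = v}. h j)"
      unfolding x by (rule prod.group[symmetric]) (use img in auto)
    also have "\<dots> = (\<Prod>v\<in>{1..L}. v ^ cnt v)"
      by (rule prod.cong) (auto simp: cnt_def)
    also have "\<dots> = F l"
      unfolding F_def l_def by (rule prod.cong) (auto simp del: upt_Suc)
    finally have "x = F l" .
    moreover have "sum_list l = k"
    proof -
      have "sum_list l = (\<Sum>v\<in>{1..L}. cnt v)"
        unfolding l_def by (simp add: interv_sum_list_conv_sum_set_nat atLeastLessThanSuc_atLeastAtMost del: upt_Suc)
      also have "\<dots> = (\<Sum>v\<in>{1..L}. \<Sum>j\<in>{j \<in> {1..k}. h j = v}. 1)" unfolding cnt_def by simp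
      also have "\<dots> = (\<Sum>j\<in>{1..k}. 1)" by (rule sum.group) (use img in auto)
      finally show ?thesis by simp
    qed
    ultimately show "x \<in> F ` W" unfolding W_def by (auto simp: l_def simp del: upt_Suc)
  qed
  show "finite P" using sub \<open>finite W\<close> finite_surj by blast
  have "card P \<le> card (F ` W)" using sub \<open>finite W\<close> by (intro card_mono) auto
  also have "\<dots> \<le> card W" by (rule card_image_le) fact
  also have "\<dots> = (k + L - 1) choose k" unfolding W_def by (rule card_length_sum_list)
  finally show "card P \<le> (k + L - 1) choose k" .
qed

text \<open>Pigeonhole: \<open>2 ^ k\<close> index sets share the possible coefficients. The factor
  2 before the binomial coefficient accounts for the sign.\<close>

lemma ex_popular_coeff:
  assumes ab: "\<And>j. j \<ge> 1 \<Longrightarrow> 1 \<le> a j \<and> a j \<le> int L \<and> 1 \<le> b j \<and> b j \<le> int L"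
    and n: "n * (2 * ((k + L - 1) choose k)) \<le> 2 ^ k"
  obtains v where "v \<noteq> 0" "\<bar>v\<bar> \<le> int L ^ k" "n \<le> card {S \<in> Pow {1..k}. coeff a b k S = v}"
proof -
  define P where "P = {\<Prod>j\<in>{1..k}. h j | h. \<forall>j\<in>{1..k}. 1 \<le> h j \<and> h j \<le> L}"
  define V where "V = coeff a b k ` Pow {1..k}"
  have abs: "\<exists>p\<in>P. \<bar>v\<bar> = int p \<and> 1 \<le> p \<and> p \<le> L ^ k" if "v \<in> V" for v
  proof -
    obtain S where v: "v = coeff a b k S" using \<open>v \<in> V\<close> unfolding V_def by auto
    define h where "h j = nat (if j \<in> S then a j else b j)" for j
    have h: "1 \<le> h j \<and> h j \<le> L" if "j \<in> {1..k}" for j using ab[of j] that unfolding h_def by auto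
    have "\<bar>v\<bar> = (\<Prod>j\<in>{1..k}. int (h j))"
      unfolding v coeff_def abs_prod by (rule prod.cong) (use ab in \<open>force simp: h_def\<close>)+
    also have "\<dots> = int (\<Prod>j\<in>{1..k}. h j)" by simp
    finally have "\<bar>v\<bar> = int (\<Prod>j\<in>{1..k}. h j)" .
    moreover have "(\<Prod>j\<in>{1..k}. h j) \<in> P" using h unfolding P_def by blast
    moreover have "1 \<le> (\<Prod>j\<in>{1..k}. h j)" using h by (intro prod_ge_1) auto
    moreover have "(\<Prod>j\<in>{1..k}. h j) \<le> (\<Prod>j\<in>{1..k}. L)" using h by (intro prod_mono) auto
    ultimately show ?thesis by (intro bexI[of _ "\<Prod>j\<in>{1..k}. h j"]) simp_all
  qed
  have "V \<subseteq> int ` P \<union> (\<lambda>p. - int p) ` P"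
  proof
    fix v assume "v \<in> V"
    then obtain p where "p \<in> P" "\<bar>v\<bar> = int p" using abs by blast
    hence "v = int p \<or> v = - int p" by linarith
    thus "v \<in> int ` P \<union> (\<lambda>p. - int p) ` P" using \<open>p \<in> P\<close> by auto
  qed
  hence "card V \<le> card (int ` P \<union> (\<lambda>p. - int p) ` P)"
    using card_bounded_products(1)[of k L] unfolding P_def by (intro card_mono) auto
  also have "\<dots> \<le> card (int ` P) + card ((\<lambda>p. - int p) ` P)" by (rule card_Un_le)
  also have "\<dots> \<le> card P + card P"
    using card_bounded_products(1)[of k L] unfolding P_def by (intro add_mono card_image_le)
  also have "\<dots> \<le> 2 * ((k + L - 1) choose k)"
    using card_bounded_products(2)[of k L] unfolding P_def by simp
  finally have card_V: "card V \<le> 2 * ((k + L - 1) choose k)" .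
  have "finite V" "V \<noteq> {}" unfolding V_def by auto
  have "\<exists>v\<in>V. n \<le> card {S \<in> Pow {1..k}. coeff a b k S = v}"
  proof (rule ccontr)
    assume "\<not> ?thesis"
    hence *: "card {S \<in> Pow {1..k}. coeff a b k S = v} < n" if "v \<in> V" for v using that by force
    have "2 ^ k = (\<Sum>S\<in>Pow {1..k}. 1 :: nat)" by (simp add: card_Pow)
    also have "\<dots> = (\<Sum>v\<in>V. \<Sum>S\<in>{S \<in> Pow {1..k}. coeff a b k S = v}. 1)"
      by (rule sum.group[symmetric]) (auto simp: V_def)
    also have "\<dots> = (\<Sum>v\<in>V. card {S \<in> Pow {1..k}. coeff a b k S = v})" by simp
    also have "\<dots> < (\<Sum>v\<in>V. n)" using * \<open>finite V\<close> \<open>V \<noteq> {}\<close> by (intro sum_strict_mono) auto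
    also have "\<dots> = card V * n" by simp
    also have "\<dots> \<le> (2 * ((k + L - 1) choose k)) * n" by (rule mult_le_mono1) (rule card_V)
    finally show False using n by (simp add: mult.commute)
  qed
  then obtain v where "v \<in> V" "n \<le> card {S \<in> Pow {1..k}. coeff a b k S = v}" by blast
  moreover obtain p where "\<bar>v\<bar> = int p" "1 \<le> p" "p \<le> L ^ k" using abs[OF \<open>v \<in> V\<close>] by blast
  ultimately show ?thesis using that[of v] by (auto simp flip: of_nat_power)
qed

text \<open>The binomial coefficient is one term of the expansion of \<open>(1 + 8) ^ (k + L)\<close>, and
  \<open>9 ^ 2 < 2 ^ 7\<close>.\<close>

lemma binomial_room:
  fixes l L :: nat
  assumes "0 < L"
  defines "k \<equiv> 32 * (l + L)"
  shows "2 ^ (l + 2 * L + 2) * (2 * ((k + L - 1) choose k)) \<le> (2 :: nat) ^ k"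
proof -
  define C where "C = (k + L - 1) choose k"
  have "C * 8 ^ k \<le> (\<Sum>i\<le>k + L - 1. ((k + L - 1) choose i) * 8 ^ i)"
    using assms(1) unfolding C_def
    by (intro member_le_sum[of k "{..k + L - 1}" "\<lambda>i. ((k + L - 1) choose i) * 8 ^ i"]) auto
  also have "\<dots> = (8 + 1) ^ (k + L - 1)" using binomial[of 8 1 "k + L - 1"] by simp
  also have "\<dots> \<le> 9 ^ (k + L)" by (simp add: power_increasing)
  also have "(9 :: nat) ^ (k + L) = 81 ^ (16 * (l + L)) * 9 ^ L"
  proof -
    have "(9 :: nat) ^ (2 * (16 * (l + L))) = 81 ^ (16 * (l + L))" by (subst power_mult) simp
    moreover have "k = 2 * (16 * (l + L))" by (simp add: k_def)
    ultimately show ?thesis by (simp only: power_add)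
  qed
  also have "\<dots> \<le> 128 ^ (16 * (l + L)) * 16 ^ L" by (intro mult_le_mono power_mono) auto
  also have "\<dots> = 2 ^ (112 * (l + L) + 4 * L)"
  proof -
    have "(2 :: nat) ^ (7 * (16 * (l + L))) = 128 ^ (16 * (l + L))" by (subst power_mult) simp
    moreover have "(2 :: nat) ^ (4 * L) = 16 ^ L" by (subst power_mult) simp
    moreover have "112 * (l + L) = 7 * (16 * (l + L))" by simp
    ultimately show ?thesis by (simp only: power_add)
  qed
  finally have "2 ^ (l + 2 * L + 2) * 2 * (C * 8 ^ k) \<le> 2 ^ (l + 2 * L + 2) * 2 * 2 ^ (112 * (l + L) + 4 * L)"
    by (rule mult_le_mono2)
  also have "\<dots> = 2 ^ (l + 2 * L + 3 + (112 * (l + L) + 4 * L))"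
  proof -
    have "l + 2 * L + 3 = Suc (l + 2 * L + 2)" by simp
    thus ?thesis by (simp only: power_add power_Suc mult_ac)
  qed
  \<comment> \<open>The left exponent is \<open>113 * l + 118 * L + 3\<close>, the right one
    \<open>128 * (l + L)\<close>. The factor 32 in \<open>k\<close> is what leaves this room: per
    unit of \<open>l + L\<close>, \<open>9 ^ 32\<close> costs at most \<open>2 ^ 112\<close> of the
    available \<open>2 ^ 128\<close>.\<close>
  also have "\<dots> \<le> 2 ^ (4 * k)" using assms(1) unfolding k_def by (intro power_increasing) auto
  also have "\<dots> = 2 ^ k * 8 ^ k" by (simp add: power_mult flip: power_mult_distrib)
  finally show ?thesis by (simp add: C_def)
qed

text \<open>Splits off the first operation, so that the other \<open>k\<close> act on
  \<open>B = a\<^sub>1 A - b\<^sub>1 A\<close> and can be expanded into dilates of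
  \<open>B\<close>.\<close>

lemma lin_iter_Suc_shift:
  "lin_iter a b (Suc k) A = lin_iter (\<lambda>j. a (Suc j)) (\<lambda>j. b (Suc j)) k (lin_op (a 1) (b 1) A)"
  by (induction k) auto

text \<open>The period is \<open>\<bar>v\<bar> * a1 * b1 * q\<close> for a popular coefficient
  \<open>v\<close>. The factors are at most \<open>L ^ k\<close>, \<open>L\<close>, \<open>L\<close>
  and \<open>2 ^ l \<le> L ^ l\<close>, which explains the exponent
  \<open>k + 2 + l\<close>.\<close>

lemma ex_period:
  fixes A :: "int set" and L l :: nat
  defines "k \<equiv> 32 * (l + L)"
  assumes "L \<ge> 2" and dens: "upper_density A > 0" and l: "1 / upper_density A \<le> 2 ^ l"
    and ab: "\<And>j. j \<ge> 1 \<Longrightarrow> 1 \<le> a j \<and> a j \<le> int L \<and> 1 \<le> b j \<and> b j \<le> int L"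
  obtains g where "0 < g" "g \<le> L ^ (k + 2 + l)" "fully_periodic (int g) (lin_iter a b (Suc k) A)"
proof -
  define M where "M = nat \<lfloor>1 / upper_density A\<rfloor>"
  obtain q where q: "0 < q" "int q \<in> diffs A" "q \<le> M"
    using ex_small_difference[OF dens] unfolding M_def by blast
  have "\<lfloor>1 / upper_density A\<rfloor> \<le> \<lfloor>(2::real) ^ l\<rfloor>" using l by (rule floor_mono)
  also have "\<lfloor>(2::real) ^ l\<rfloor> = 2 ^ l" by (metis floor_numeral_power)
  finally have M: "M \<le> 2 ^ l" unfolding M_def by (simp add: nat_le_iff)
  define a1 b1 where "a1 = nat (a 1)" and "b1 = nat (b 1)"
  have a1: "0 < a1" "a1 \<le> L" "int a1 = a 1" and b1: "0 < b1" "b1 \<le> L" "int b1 = b 1"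
    using ab[of 1] unfolding a1_def b1_def by auto
  define B where "B = lin_op (a 1) (b 1) A"
  define a' b' where "a' j = a (Suc j)" and "b' j = b (Suc j)" for j
  \<comment> \<open>This is the number of copies of \<open>B\<close> that makes their sum periodic;
    it is compared with the multiplicity guaranteed by \<open>binomial_room\<close>.\<close>
  have "2 * M * (a1 + b1) + a1 * b1 * q \<le> 2 * 2 ^ l * (L + L) + L * L * 2 ^ l"
    using M q(3) a1(2) b1(2) by (intro add_mono mult_mono) auto
  also have "\<dots> = 2 ^ l * (4 * L + L * L)" by (simp add: algebra_simps)
  also have "4 * L + L * L \<le> 4 * 2 ^ L * 2 ^ L"
  proof -
    have "4 * L \<le> 2 * (L * L)" using mult_le_mono1[OF \<open>L \<ge> 2\<close>, of L] by simp
    moreover have "L * L \<le> 2 ^ L * 2 ^ L" using less_exp[of L] by (intro mult_mono) auto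
    ultimately have "4 * L + L * L \<le> 4 * (2 ^ L * 2 ^ L)" by linarith
    thus ?thesis by simp
  qed
  also have "2 ^ l * (4 * 2 ^ L * 2 ^ L) = (2 :: nat) ^ (l + 2 * L + 2)"
    by (simp add: power_add mult_2)
  finally have size: "2 * M * (a1 + b1) + a1 * b1 * q \<le> 2 ^ (l + 2 * L + 2)" by simp
  obtain v where v: "v \<noteq> 0" "\<bar>v\<bar> \<le> int L ^ k"
    "2 ^ (l + 2 * L + 2) \<le> card {S \<in> Pow {1..k}. coeff a' b' k S = v}"
    using ex_popular_coeff[of a' L b' "2 ^ (l + 2 * L + 2)" k] binomial_room[of L l] ab \<open>L \<ge> 2\<close>
    unfolding a'_def b'_def k_def by auto
  define I where "I = {S \<in> Pow {1..k}. coeff a' b' k S = v}"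
  have "fully_periodic (int (a1 * b1 * q)) (nsum (card I) B)"
    using fully_periodic_nsum_lin_op[OF dens a1(1) b1(1) q(1,2), of "card I"] size v(3)
    unfolding B_def I_def a1(3) b1(3) M_def by simp
  hence "fully_periodic (v * int (a1 * b1 * q)) (v *o nsum (card I) B)" by (rule fully_periodic_mult)
  also have "v *o nsum (card I) B = (\<Sum>S\<in>I. coeff a' b' k S *o B)"
  proof -
    have "finite I" unfolding I_def by auto
    hence "v *o nsum (card I) B = (\<Sum>S\<in>I. v *o B)" by (simp add: elt_set_times_sum flip: sum_const_set)
    also have "\<dots> = (\<Sum>S\<in>I. coeff a' b' k S *o B)" by (rule sum.cong) (auto simp: I_def)
    finally show ?thesis .
  qed
  finally have "fully_periodic (v * int (a1 * b1 * q))
      ((\<Sum>S\<in>I. coeff a' b' k S *o B) + (\<Sum>S\<in>Pow {1..k} - I. coeff a' b' k S *o B))"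
    by (rule fully_periodic_plus)
  also have "(\<Sum>S\<in>I. coeff a' b' k S *o B) + (\<Sum>S\<in>Pow {1..k} - I. coeff a' b' k S *o B)
      = lin_iter a b (Suc k) A"
  proof -
    have "lin_iter a b (Suc k) A = (\<Sum>S\<in>Pow {1..k}. coeff a' b' k S *o B)"
      using lin_iter_eq_sum[of a' b' k B] unfolding lin_iter_Suc_shift B_def a'_def b'_def .
    also have "\<dots> = (\<Sum>S\<in>Pow {1..k} - I. coeff a' b' k S *o B) + (\<Sum>S\<in>I. coeff a' b' k S *o B)"
      by (rule sum.subset_diff) (auto simp: I_def)
    finally show ?thesis by (simp add: add.commute)
  qed
  finally have per: "fully_periodic (v * int (a1 * b1 * q)) (lin_iter a b (Suc k) A)" .
  define g where "g = nat \<bar>v\<bar> * (a1 * b1 * q)"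
  \<comment> \<open>A popular coefficient may be negative; a period may be replaced by its
    negative.\<close>
  have "int g = v * int (a1 * b1 * q) \<or> int g = - (v * int (a1 * b1 * q))"
    unfolding g_def by (cases "v \<ge> 0") auto
  hence "fully_periodic (int g) (lin_iter a b (Suc k) A)" using per fully_periodic_uminus by auto
  moreover have "0 < g" using v(1) a1(1) b1(1) q(1) unfolding g_def by simp
  moreover have "g \<le> L ^ (k + 2 + l)"
  proof -
    have "nat \<bar>v\<bar> \<le> L ^ k" using v(2) by (simp add: nat_le_iff)
    moreover have "q \<le> L ^ l" using q(3) M power_mono[OF \<open>L \<ge> 2\<close>, of l] by simp
    ultimately have "g \<le> L ^ k * (L * L * L ^ l)"
      unfolding g_def using a1(2) b1(2) by (intro mult_mono) auto
    thus ?thesis by (simp add: power_add power2_eq_square mult_ac)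
  qed
  ultimately show ?thesis using that by blast
qed

section \<open>Residue classes met by a set\<close>

text \<open>Take \<open>g1\<close> as the largest divisor of \<open>g\<close> coprime to
  \<open>b\<close>. A prime dividing \<open>g2\<close> but not \<open>b\<close> could be moved into
  \<open>g1\<close>, against maximality. So all primes of \<open>g2\<close> divide \<open>b\<close>,
  and whatever is coprime to \<open>b\<close>, such as \<open>a\<close> and \<open>g1\<close>, is
  coprime to \<open>g2\<close>.\<close>

lemma coprime_splitting:
  fixes g a b :: int
  assumes "0 < g" "coprime a b"
  obtains g1 g2 where "0 < g1" "0 < g2" "g = g1 * g2" "coprime g1 g2" "coprime b g1" "coprime a g2"
proof -
  define D where "D = {d. 0 < d \<and> d dvd g \<and> coprime d b}"
  have "D \<subseteq> {1..g}" unfolding D_def using assms(1) by (auto intro: zdvd_imp_le)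
  hence "finite D" using finite_subset by blast
  have "1 \<in> D" by (simp add: D_def)
  define g1 where "g1 = Max D"
  have "g1 \<in> D" unfolding g1_def using \<open>finite D\<close> \<open>1 \<in> D\<close> by (intro Max_in) auto
  then obtain g2 where g: "0 < g1" "g = g1 * g2" "coprime g1 b" unfolding D_def by auto
  have "0 < g2" using g assms(1) by (simp add: zero_less_mult_iff)
  have dvd_b: "p dvd b" if "prime p" "p dvd g2" for p
  proof (rule ccontr)
    assume "\<not> p dvd b"
    hence "coprime (g1 * p) b" using g(3) \<open>prime p\<close> prime_imp_coprime by auto
    moreover have "0 < p" using \<open>prime p\<close> by (rule prime_gt_0_int)
    ultimately have "g1 * p \<in> D" unfolding D_def using g that(2) by auto
    hence "g1 * p \<le> g1" unfolding g1_def using \<open>finite D\<close> by (intro Max_ge)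
    thus False using \<open>0 < g1\<close> prime_gt_1_int[OF \<open>prime p\<close>] by simp
  qed
  have coprime_g2: "coprime c g2" if "coprime c b" for c
  proof (rule ccontr)
    assume "\<not> coprime c g2"
    hence "gcd c g2 \<noteq> 0" "\<not> is_unit (gcd c g2)" using \<open>0 < g2\<close> by auto
    then obtain p where p: "p dvd gcd c g2" "prime p" using prime_divisor_exists by blast
    hence "p dvd c" "p dvd b" using dvd_b[of p] by auto
    hence "is_unit p" using that coprime_common_divisor by blast
    thus False using \<open>prime p\<close> not_prime_unit by blast
  qed
  have "coprime a g2" "coprime g1 g2" using coprime_g2 assms(2) g(3) by auto
  thus ?thesis using that[of g1 g2] g \<open>0 < g2\<close> by (simp add: coprime_commute)
qed

section \<open>Class counts and affine images modulo \<open>g\<close>\<close>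

definition ncls :: "int \<Rightarrow> int set \<Rightarrow> nat" where
  "ncls g X = card ((\<lambda>x. x mod g) ` X)"

lemma finite_residues: "0 < g \<Longrightarrow> finite ((\<lambda>x::int. x mod g) ` X)"
  by (rule finite_subset[of _ "{0..<g}"]) auto

lemma ncls_le: "0 < g \<Longrightarrow> ncls g X \<le> nat g"
proof -
  assume "0 < g"
  hence "(\<lambda>x. x mod g) ` X \<subseteq> {0..<g}" by auto
  from card_mono[OF _ this] show ?thesis unfolding ncls_def by simp
qed

lemma ncls_pos: "0 < g \<Longrightarrow> X \<noteq> {} \<Longrightarrow> 0 < ncls g X"
  unfolding ncls_def by (simp add: card_gt_0_iff finite_residues)

lemma ncls_mono: "0 < g \<Longrightarrow> X \<subseteq> Y \<Longrightarrow> ncls g X \<le> ncls g Y"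
  unfolding ncls_def by (intro card_mono finite_residues image_mono)

text \<open>A periodic set is a union of full classes, so it contains every superset that meets no
  further class.\<close>

lemma ncls_le_imp_eq:
  assumes "0 < g" "fully_periodic g X" "X \<subseteq> Y" "ncls g Y \<le> ncls g X"
  shows "X = Y"
proof
  have "(\<lambda>x. x mod g) ` X = (\<lambda>x. x mod g) ` Y"
    using assms unfolding ncls_def by (intro card_seteq finite_residues image_mono)
  show "Y \<subseteq> X"
  proof
    fix y assume "y \<in> Y"
    hence "y mod g \<in> (\<lambda>x. x mod g) ` X" using \<open>_ = (\<lambda>x. x mod g) ` Y\<close> by blast
    then obtain x where "x \<in> X" "[x = y] (mod g)" unfolding cong_def by auto
    thus "y \<in> X" by (rule fully_periodic_cong[OF assms(2)])
  qed
qed fact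

text \<open>On \<open>X\<close>, the map \<open>f\<close> induces a bijection from classes modulo
  \<open>g\<close> to classes modulo \<open>h\<close>; \<open>r\<close> picks representatives. Two
  moduli are allowed for the sake of the parametrisation of fibres, which passes from
  \<open>g1\<close> to \<open>g1 * g2\<close>.\<close>

lemma ncls_inj_mod:
  assumes "\<And>x y. x \<in> X \<Longrightarrow> y \<in> X \<Longrightarrow> [f x = f y] (mod h) \<longleftrightarrow> [x = y] (mod g)"
  shows "card ((\<lambda>x. f x mod h) ` X) = ncls g X"
proof -
  have "\<forall>s\<in>(\<lambda>x. x mod g) ` X. \<exists>x\<in>X. x mod g = s" by blast
  then obtain r where r: "\<And>s. s \<in> (\<lambda>x. x mod g) ` X \<Longrightarrow> r s \<in> X \<and> r s mod g = s" by metis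
  have "bij_betw (\<lambda>s. f (r s) mod h) ((\<lambda>x. x mod g) ` X) ((\<lambda>x. f x mod h) ` X)"
    unfolding bij_betw_def
  proof
    show "inj_on (\<lambda>s. f (r s) mod h) ((\<lambda>x. x mod g) ` X)"
    proof (rule inj_onI)
      fix s s' assume s: "s \<in> (\<lambda>x. x mod g) ` X" "s' \<in> (\<lambda>x. x mod g) ` X"
        "f (r s) mod h = f (r s') mod h"
      hence "[r s = r s'] (mod g)"
        using assms[of "r s" "r s'"] r[OF s(1)] r[OF s(2)] unfolding cong_def by blast
      thus "s = s'" using r[OF s(1)] r[OF s(2)] unfolding cong_def by simp
    qed
    show "(\<lambda>s. f (r s) mod h) ` (\<lambda>x. x mod g) ` X = (\<lambda>x. f x mod h) ` X"
    proof (intro subset_antisym subsetI)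
      fix z assume "z \<in> (\<lambda>x. f x mod h) ` X"
      then obtain x where x: "x \<in> X" "z = f x mod h" by auto
      hence "r (x mod g) \<in> X" "[r (x mod g) = x] (mod g)" using r[of "x mod g"] unfolding cong_def by auto
      hence "[f (r (x mod g)) = f x] (mod h)" using assms x(1) by blast
      hence "z = f (r (x mod g)) mod h" using x(2) unfolding cong_def by simp
      thus "z \<in> (\<lambda>s. f (r s) mod h) ` (\<lambda>x. x mod g) ` X" using x(1) by auto
    next
      fix z assume "z \<in> (\<lambda>s. f (r s) mod h) ` (\<lambda>x. x mod g) ` X"
      then obtain s where "s \<in> (\<lambda>x. x mod g) ` X" "z = f (r s) mod h" by blast
      thus "z \<in> (\<lambda>x. f x mod h) ` X" using r by blast
    qed
  qed
  thus ?thesis unfolding ncls_def using bij_betw_same_card by metis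
qed

text \<open>The image is saturated to full residue classes, so that it can equal a periodic set of
  integers.\<close>

definition affine_image :: "int \<Rightarrow> int \<Rightarrow> int \<Rightarrow> int set \<Rightarrow> int set" where
  "affine_image g u t X = {z. \<exists>x\<in>X. [z = u * x + t] (mod g)}"

lemma fully_periodic_affine_image: "fully_periodic g (affine_image g u t X)"
  unfolding fully_periodic_iff affine_image_def cong_def by auto

lemma ncls_affine_image:
  assumes "0 < g" "coprime u g"
  shows "ncls g (affine_image g u t X) = ncls g X"
proof -
  have "(\<lambda>z. z mod g) ` affine_image g u t X = (\<lambda>x. (u * x + t) mod g) ` X"
  proof (intro subset_antisym subsetI)
    fix w assume "w \<in> (\<lambda>x. (u * x + t) mod g) ` X"
    then obtain x where "x \<in> X" "w = (u * x + t) mod g" by blast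
    moreover from this have "u * x + t \<in> affine_image g u t X"
      unfolding affine_image_def by (auto intro: cong_refl)
    ultimately show "w \<in> (\<lambda>z. z mod g) ` affine_image g u t X" by blast
  qed (auto simp: affine_image_def cong_def)
  moreover have "card ((\<lambda>x. (u * x + t) mod g) ` X) = ncls g X"
    using assms by (intro ncls_inj_mod) (simp add: cong_add_rcancel cong_mult_lcancel coprime_commute)
  ultimately show ?thesis unfolding ncls_def by simp
qed

lemma affine_image_affine_image:
  "affine_image g u t (affine_image g v s X) = affine_image g (u * v) (u * s + t) X"
proof (intro set_eqI iffI)
  fix z assume "z \<in> affine_image g u t (affine_image g v s X)"
  then obtain x y where *: "x \<in> X" "[y = v * x + s] (mod g)" "[z = u * y + t] (mod g)"
    unfolding affine_image_def by auto
  have "[u * y + t = u * (v * x + s) + t] (mod g)" using *(2) by (intro cong_add cong_mult cong_refl)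
  from cong_trans[OF *(3) this] have "[z = u * v * x + (u * s + t)] (mod g)" by (simp add: algebra_simps)
  thus "z \<in> affine_image g (u * v) (u * s + t) X" using *(1) unfolding affine_image_def by auto
next
  fix z assume "z \<in> affine_image g (u * v) (u * s + t) X"
  then obtain x where "x \<in> X" "[z = u * (v * x + s) + t] (mod g)"
    unfolding affine_image_def by (auto simp: algebra_simps)
  moreover from this have "v * x + s \<in> affine_image g v s X"
    unfolding affine_image_def by (auto intro: cong_refl)
  ultimately show "z \<in> affine_image g u t (affine_image g v s X)"
    unfolding affine_image_def[of g u t] by blast
qed

text \<open>Leaves at most \<open>g ^ 2\<close> affine images of a given set.\<close>

lemma affine_image_mod: "affine_image g (u mod g) (t mod g) X = affine_image g u t X"
proof -
  have "[u mod g * x + t mod g = u * x + t] (mod g)" for x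
    by (intro cong_add cong_mult cong_refl) (simp_all add: cong_def)
  hence "(u mod g * x + t mod g) mod g = (u * x + t) mod g" for x unfolding cong_def .
  thus ?thesis unfolding affine_image_def cong_def by simp
qed

lemma affine_image_id:
  assumes "fully_periodic g X"
  shows "affine_image g 1 0 X = X"
proof (intro set_eqI iffI)
  fix z assume "z \<in> affine_image g 1 0 X"
  then obtain x where "x \<in> X" "[x = z] (mod g)" unfolding affine_image_def by (auto simp: cong_sym_eq)
  thus "z \<in> X" by (rule fully_periodic_cong[OF assms])
qed (auto simp: affine_image_def intro: cong_refl)

section \<open>Fibres modulo \<open>g2\<close> and growth of the class count\<close>

locale split_op =
  fixes g1 g2 a b :: int and X :: "int set"
  assumes pos: "0 < g1" "0 < g2" and cop: "coprime g1 g2" "coprime b g1" "coprime a g2"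
    and coprime_ab: "coprime a b" and per: "fully_periodic (g1 * g2) X" and ne: "X \<noteq> {}"
begin

text \<open>The part of \<open>Z\<close> congruent to \<open>z\<close> modulo \<open>g2\<close>, in
  the coordinate \<open>t\<close>, which matters modulo \<open>g1\<close> when \<open>Z\<close> is
  periodic modulo \<open>g1 * g2\<close>. Another base point in the same class translates the
  fibre.\<close>

definition fibre :: "int set \<Rightarrow> int \<Rightarrow> int set" where
  "fibre Z z = {t. z + g2 * t \<in> Z}"

definition Y where "Y = lin_op a b X"

definition cls :: "int set \<Rightarrow> int set" where "cls Z = (\<lambda>z. z mod g2) ` Z"

definition fsize :: "int set \<Rightarrow> int \<Rightarrow> nat" where
  "fsize Z s = card {r \<in> (\<lambda>z. z mod (g1 * g2)) ` Z. r mod g2 = s}"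

lemma per_Y: "fully_periodic (g1 * g2) Y"
  unfolding Y_def by (rule fully_periodic_lin_op[OF per coprime_ab])

lemma Y_I: "x \<in> X \<Longrightarrow> y \<in> X \<Longrightarrow> a * y - b * x \<in> Y"
  unfolding Y_def lin_op_def by blast

lemma fibre_periodic:
  assumes "fully_periodic (g1 * g2) Z"
  shows "fully_periodic g1 (fibre Z z)"
  unfolding fully_periodic_iff
proof
  fix t assume "t \<in> fibre Z z"
  hence "(z + g2 * t) + g1 * g2 \<in> Z \<and> (z + g2 * t) - g1 * g2 \<in> Z"
    using assms unfolding fibre_def fully_periodic_iff by blast
  moreover have "(z + g2 * t) + g1 * g2 = z + g2 * (t + g1)" "(z + g2 * t) - g1 * g2 = z + g2 * (t - g1)"
    by (simp_all add: algebra_simps)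
  ultimately show "t + g1 \<in> fibre Z z \<and> t - g1 \<in> fibre Z z" unfolding fibre_def by simp
qed

lemma fsize_fibre: "fsize Z (z mod g2) = ncls g1 (fibre Z z)"
proof -
  have "{r \<in> (\<lambda>z. z mod (g1 * g2)) ` Z. r mod g2 = z mod g2}
      = (\<lambda>t. (z + g2 * t) mod (g1 * g2)) ` fibre Z z" (is "?L = ?R")
  proof (intro subset_antisym subsetI)
    fix r assume "r \<in> ?L"
    then obtain w where w: "w \<in> Z" "r = w mod (g1 * g2)" "w mod g2 = z mod g2"
      by (auto simp: mod_mod_cancel)
    hence "[z = w] (mod g2)" by (simp add: cong_def)
    then obtain t where "w = z + g2 * t" by (auto simp: cong_iff_lin)
    thus "r \<in> ?R" using w unfolding fibre_def by auto
  next
    fix r assume "r \<in> ?R"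
    thus "r \<in> ?L" unfolding fibre_def by (auto simp: mod_mod_cancel)
  qed
  moreover have "card \<dots> = ncls g1 (fibre Z z)"
  proof (rule ncls_inj_mod)
    fix s t
    have "[z + g2 * s = z + g2 * t] (mod g1 * g2) \<longleftrightarrow> g1 * g2 dvd g2 * (s - t)"
      by (simp add: cong_iff_dvd_diff right_diff_distrib)
    also have "\<dots> \<longleftrightarrow> [s = t] (mod g1)"
      using pos by (simp add: cong_iff_dvd_diff mult.commute)
    finally show "[z + g2 * s = z + g2 * t] (mod g1 * g2) \<longleftrightarrow> [s = t] (mod g1)" .
  qed
  ultimately show ?thesis unfolding fsize_def by simp
qed

lemma ncls_eq_sum: "ncls (g1 * g2) Z = (\<Sum>s\<in>cls Z. fsize Z s)"
proof -
  have "ncls (g1 * g2) Z = (\<Sum>r\<in>(\<lambda>z. z mod (g1 * g2)) ` Z. 1)" unfolding ncls_def by simp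
  also have "\<dots> = (\<Sum>s\<in>cls Z. \<Sum>r\<in>{r \<in> (\<lambda>z. z mod (g1 * g2)) ` Z. r mod g2 = s}. 1)"
    unfolding cls_def by (rule sum.group[symmetric]) (use pos in \<open>auto simp: finite_residues mod_mod_cancel\<close>)
  finally show ?thesis unfolding fsize_def by simp
qed

lemma finite_cls [simp]: "finite (cls Z)"
  unfolding cls_def using pos by (intro finite_residues)

lemma fsize_pos:
  assumes "s \<in> cls Z"
  shows "0 < fsize Z s"
proof -
  obtain z where "z \<in> Z" "s = z mod g2" using assms unfolding cls_def by blast
  hence "0 \<in> fibre Z z" unfolding fibre_def by simp
  thus ?thesis using ncls_pos[OF pos(1), of "fibre Z z"] \<open>s = z mod g2\<close> by (auto simp: fsize_fibre)
qed

definition reach :: "int \<Rightarrow> int set" where "reach x = (\<lambda>y. (a * y - b * x) mod g2) ` X"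

text \<open>As \<open>a\<close> is a unit modulo \<open>g2\<close>, the map
  \<open>y \<mapsto> a * y - b * x\<close> is injective on classes modulo \<open>g2\<close>.\<close>

lemma card_reach: "card (reach x) = card (cls X)"
proof -
  have "card ((\<lambda>y. (a * y - b * x) mod g2) ` X) = ncls g2 X"
    using cop(3) by (intro ncls_inj_mod)
      (simp add: cong_iff_dvd_diff coprime_dvd_mult_right_iff coprime_commute flip: right_diff_distrib)
  thus ?thesis unfolding reach_def cls_def ncls_def .
qed

lemma reach_subset: "x \<in> X \<Longrightarrow> reach x \<subseteq> cls Y"
  unfolding reach_def cls_def using Y_I by auto

text \<open>With \<open>y\<close> fixed, replacing \<open>x\<close> by \<open>x + g2 * s\<close>
  stays in the same class modulo \<open>g2\<close> and moves the coordinate by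
  \<open>- b * s\<close>; here \<open>- b\<close> is a unit modulo \<open>g1\<close>.\<close>

lemma image_fibre_subset:
  assumes "x \<in> X" "y \<in> X"
  shows "affine_image g1 (- b) 0 (fibre X x) \<subseteq> fibre Y (a * y - b * x)"
proof
  fix t assume "t \<in> affine_image g1 (- b) 0 (fibre X x)"
  then obtain s where s: "x + g2 * s \<in> X" "[t = - b * s] (mod g1)"
    unfolding affine_image_def fibre_def by auto
  have "a * y - b * (x + g2 * s) \<in> Y" using Y_I[OF s(1) assms(2)] .
  hence "- b * s \<in> fibre Y (a * y - b * x)" unfolding fibre_def by (simp add: algebra_simps)
  thus "t \<in> fibre Y (a * y - b * x)"
    by (rule fully_periodic_cong[OF fibre_periodic[OF per_Y] _ cong_sym[OF s(2)]])
qed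

lemma ncls_image_fibre: "ncls g1 (affine_image g1 (- b) 0 (fibre X x)) = fsize X (x mod g2)"
  using ncls_affine_image[OF pos(1), of "- b"] cop(2) by (simp add: fsize_fibre)

lemma fsize_le:
  assumes "x \<in> X" "s \<in> reach x"
  shows "fsize X (x mod g2) \<le> fsize Y s"
proof -
  obtain y where y: "y \<in> X" "s = (a * y - b * x) mod g2" using assms(2) unfolding reach_def by blast
  from ncls_mono[OF pos(1) image_fibre_subset[OF assms(1) y(1)]] show ?thesis
    unfolding ncls_image_fibre y(2) fsize_fibre .
qed

definition f where "f = Max (fsize X ` cls X)"

lemma fsize_le_f: "s \<in> cls X \<Longrightarrow> fsize X s \<le> f"
  unfolding f_def by (intro Max_ge) auto

lemma ex_max_fibre: "\<exists>x\<in>X. fsize X (x mod g2) = f"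
proof -
  have "cls X \<noteq> {}" using ne by (simp add: cls_def)
  hence "f \<in> fsize X ` cls X" unfolding f_def by (intro Max_in) auto
  thus ?thesis unfolding cls_def by auto
qed

lemma sum_reach_ge:
  assumes "x \<in> X" "fsize X (x mod g2) = f"
  shows "f * card (cls X) \<le> (\<Sum>s\<in>reach x. fsize Y s)"
proof -
  have "f * card (cls X) = (\<Sum>s\<in>reach x. f)" by (simp add: card_reach)
  also have "\<dots> \<le> (\<Sum>s\<in>reach x. fsize Y s)" using fsize_le[OF assms(1)] assms(2) by (intro sum_mono) auto
  finally show ?thesis .
qed

lemma sum_reach_le: "x \<in> X \<Longrightarrow> (\<Sum>s\<in>reach x. fsize Y s) \<le> ncls (g1 * g2) Y"
  unfolding ncls_eq_sum by (intro sum_mono2 reach_subset) auto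

lemma ncls_X_le: "ncls (g1 * g2) X \<le> f * card (cls X)"
  unfolding ncls_eq_sum using sum_bounded_above[of "cls X" "fsize X" f] fsize_le_f by (simp add: mult.commute)

text \<open>Fix \<open>x\<close> in a largest fibre of \<open>X\<close>. From it
  \<open>card (cls X)\<close> classes modulo \<open>g2\<close> are reached, and over each of them
  \<open>Y\<close> has a fibre of size at least \<open>f\<close>.\<close>

lemma ncls_lin_op_ge: "ncls (g1 * g2) X \<le> ncls (g1 * g2) Y"
proof -
  obtain x where x: "x \<in> X" "fsize X (x mod g2) = f" using ex_max_fibre by blast
  show ?thesis using ncls_X_le sum_reach_ge[OF x] sum_reach_le[OF x(1)] by linarith
qed

section \<open>The case of equal class counts\<close>

context
  assumes eq: "ncls (g1 * g2) Y = ncls (g1 * g2) X"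
begin

text \<open>Equality turns the whole chain of estimates into equalities, and a sum attains its
  termwise upper bound only if every term does.\<close>

lemma fsize_X: "x \<in> X \<Longrightarrow> fsize X (x mod g2) = f"
proof -
  assume "x \<in> X"
  have "(\<Sum>s\<in>cls X. fsize X s) = (\<Sum>s\<in>cls X. f)"
  proof -
    obtain x where x: "x \<in> X" "fsize X (x mod g2) = f" using ex_max_fibre by blast
    have "ncls (g1 * g2) X = f * card (cls X)"
      using ncls_X_le sum_reach_ge[OF x] sum_reach_le[OF x(1)] eq by linarith
    thus ?thesis unfolding ncls_eq_sum by simp
  qed
  hence "fsize X s = f" if "s \<in> cls X" for s
    using sum_mono_inv[of "fsize X" "cls X" "\<lambda>_. f" s] fsize_le_f that by simp
  thus ?thesis using \<open>x \<in> X\<close> unfolding cls_def by blast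
qed

lemma sum_reach:
  assumes "x \<in> X"
  shows "(\<Sum>s\<in>reach x. fsize Y s) = f * card (cls X)" "(\<Sum>s\<in>cls Y. fsize Y s) = f * card (cls X)"
  using sum_reach_ge[OF assms fsize_X[OF assms]] sum_reach_le[OF assms] ncls_X_le eq
  unfolding ncls_eq_sum by auto

text \<open>The fibres over \<open>reach x\<close> already exhaust the class count of
  \<open>Y\<close>, and a further class would carry a nonempty fibre.\<close>

lemma reach_eq: "x \<in> X \<Longrightarrow> reach x = cls Y"
proof (rule ccontr)
  assume "x \<in> X" "reach x \<noteq> cls Y"
  then obtain s where "s \<in> cls Y" "s \<notin> reach x" using reach_subset by blast
  hence "(\<Sum>s\<in>reach x. fsize Y s) < (\<Sum>s\<in>cls Y. fsize Y s)"
    using reach_subset[OF \<open>x \<in> X\<close>] fsize_pos[of s Y] by (intro sum_strict_mono2[of _ _ s]) auto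
  thus False using sum_reach[OF \<open>x \<in> X\<close>] by simp
qed

lemma fsize_Y:
  assumes "x \<in> X" "y \<in> X"
  shows "fsize Y ((a * y - b * x) mod g2) = f"
proof -
  have "finite (reach x)" using reach_eq[OF assms(1)] by simp
  have "(\<Sum>s\<in>reach x. f) = (\<Sum>s\<in>reach x. fsize Y s)"
    using sum_reach(1)[OF assms(1)] by (simp add: card_reach)
  hence "f = fsize Y s" if "s \<in> reach x" for s
    using sum_mono_inv[of "\<lambda>_. f" "reach x" "fsize Y" s] fsize_le[OF assms(1)] fsize_X[OF assms(1)]
      that \<open>finite (reach x)\<close> by simp
  moreover have "(a * y - b * x) mod g2 \<in> reach x" using assms(2) unfolding reach_def by blast
  ultimately show ?thesis by simp
qed

lemma fibre_Y:
  assumes "x \<in> X" "y \<in> X"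
  shows "fibre Y (a * y - b * x) = affine_image g1 (- b) 0 (fibre X x)"
  using ncls_le_imp_eq[OF pos(1) fully_periodic_affine_image image_fibre_subset[OF assms]]
    fsize_Y[OF assms] fsize_X[OF assms(1)] by (simp add: ncls_image_fibre fsize_fibre)

text \<open>Inverts multiplication by \<open>- b\<close> in \<open>fibre_Y\<close>. The right-hand
  side does not involve \<open>y\<close>; comparing different \<open>y\<close> yields the
  translation invariances in \<open>rectangle\<close>.\<close>

lemma mem_Y_iff:
  assumes "x \<in> X" "y \<in> X" "[b * b' = 1] (mod g1)"
  shows "a * y - b * x + g2 * t \<in> Y \<longleftrightarrow> x - g2 * (b' * t) \<in> X"
proof -
  have inv: "[t = - b * s] (mod g1) \<longleftrightarrow> [- (b' * t) = s] (mod g1)" for s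
  proof
    assume "[t = - b * s] (mod g1)"
    hence "[- (b' * t) = - (b' * (- b * s))] (mod g1)"
      unfolding cong_minus_minus_iff by (intro cong_mult cong_refl)
    also have "- (b' * (- b * s)) = (b * b') * s" by simp
    also have "[(b * b') * s = 1 * s] (mod g1)" using assms(3) by (intro cong_mult cong_refl)
    finally show "[- (b' * t) = s] (mod g1)" by simp
  next
    assume "[- (b' * t) = s] (mod g1)"
    hence "[s = - (b' * t)] (mod g1)" by (rule cong_sym)
    hence "[- b * s = - b * (- (b' * t))] (mod g1)" by (intro cong_mult cong_refl)
    also have "- b * (- (b' * t)) = (b * b') * t" by simp
    also have "[(b * b') * t = 1 * t] (mod g1)" using assms(3) by (intro cong_mult cong_refl)
    finally show "[t = - b * s] (mod g1)" by (simp add: cong_sym_eq)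
  qed
  have "a * y - b * x + g2 * t \<in> Y \<longleftrightarrow> t \<in> affine_image g1 (- b) 0 (fibre X x)"
    unfolding fibre_Y[OF assms(1,2), symmetric] by (simp add: fibre_def)
  also have "\<dots> \<longleftrightarrow> (\<exists>s\<in>fibre X x. [- (b' * t) = s] (mod g1))"
    unfolding affine_image_def mem_Collect_eq add_0_right inv ..
  also have "\<dots> \<longleftrightarrow> - (b' * t) \<in> fibre X x"
  proof
    assume "\<exists>s\<in>fibre X x. [- (b' * t) = s] (mod g1)"
    then obtain s where "s \<in> fibre X x" "[- (b' * t) = s] (mod g1)" by blast
    thus "- (b' * t) \<in> fibre X x"
      using fully_periodic_cong[OF fibre_periodic[OF per] _ cong_sym] by blast
  next
    assume "- (b' * t) \<in> fibre X x"
    thus "\<exists>s\<in>fibre X x. [- (b' * t) = s] (mod g1)" by (rule bexI[rotated]) (rule cong_refl)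
  qed
  finally show ?thesis unfolding fibre_def by simp
qed

text \<open>Passing from \<open>x\<close> to \<open>x'\<close> translates the fibre by some \<open>s\<close>, well defined modulo the stabiliser \<open>S\<close> of
  the fibre. The same translation occurs along every step of a cycle in the second component, whose
  length is prime to \<open>g1\<close>; this determines \<open>s\<close> modulo \<open>S\<close>.\<close>

lemma rectangle:
  assumes "x \<in> X" "x' \<in> X"
  shows "\<exists>p\<in>X. [p = x] (mod g1) \<and> [p = x'] (mod g2)"
proof -
  obtain b' where b': "[b * b' = 1] (mod g1)" using cop(2) cong_solve_coprime_int by blast
  obtain c where c: "[g2 * c = 1] (mod g1)" using cop(1) cong_solve_coprime_int coprime_commute by blast
  define Q where "Q t \<longleftrightarrow> x - g2 * (b' * t) \<in> X" for t
  define S where "S = {d. \<forall>t. Q (t + d) \<longleftrightarrow> Q t}"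
  have S_0: "0 \<in> S" unfolding S_def by simp
  have S_add: "d + e \<in> S" if "d \<in> S" "e \<in> S" for d e
    using that unfolding S_def by (simp add: add.assoc[symmetric])
  have S_uminus: "- d \<in> S" if "d \<in> S" for d
  proof -
    have "Q (t + - d) \<longleftrightarrow> Q t" for t
      using that[unfolded S_def, simplified, rule_format, of "t - d"] by simp
    thus ?thesis unfolding S_def by simp
  qed
  have S_diff: "d - e \<in> S" if "d \<in> S" "e \<in> S" for d e
    using S_add[OF that(1) S_uminus[OF that(2)]] by simp
  have S_mult: "m * d \<in> S" if "d \<in> S" for m d
  proof (induction m rule: int_induct[where k = 0])
    case base show ?case using S_0 by simp
  next
    case (step1 i) thus ?case using S_add[of "i * d" d] that by (simp add: algebra_simps)
  next
    case (step2 i) thus ?case using S_diff[of "i * d" d] that by (simp add: algebra_simps)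
  qed
  have S_g1: "g1 \<in> S"
  proof -
    have "Q (t + g1) \<longleftrightarrow> Q t" for t
    proof -
      have "x - g2 * (b' * (t + g1)) = x - g2 * (b' * t) + (g1 * g2) * (- b')"
        and "x - g2 * (b' * t) = x - g2 * (b' * (t + g1)) + (g1 * g2) * b'" by (simp_all add: algebra_simps)
      from fully_periodic_add_mult[OF per, of "x - g2 * (b' * t)" "- b'", folded this(1)]
        fully_periodic_add_mult[OF per, of "x - g2 * (b' * (t + g1))" b', folded this(2)]
      show ?thesis unfolding Q_def by blast
    qed
    thus ?thesis unfolding S_def by simp
  qed
  have S_cong: "e \<in> S" if d: "d \<in> S" and de: "[d = e] (mod g1)" for d e
  proof -
    obtain k where "e = d + g1 * k" using de by (auto simp: cong_iff_lin)
    thus ?thesis using S_add[OF d S_mult[OF S_g1, of k]] by (simp add: mult.commute)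
  qed
  \<comment> \<open>The base points from \<open>y\<close> and \<open>y + g2 * w\<close> describe the
    same fibre of \<open>Y\<close>, in coordinates that differ by \<open>a * w\<close>.\<close>
  have S_fibre: "a * w \<in> S" if "y \<in> X" "y + g2 * w \<in> X" for y w
  proof -
    have "Q (t + a * w) \<longleftrightarrow> Q t" for t
    proof -
      have "Q (t + a * w) \<longleftrightarrow> a * y - b * x + g2 * (t + a * w) \<in> Y"
        unfolding Q_def using mem_Y_iff[OF assms(1) that(1) b'] by simp
      also have "a * y - b * x + g2 * (t + a * w) = a * (y + g2 * w) - b * x + g2 * t"
        by (simp add: algebra_simps)
      also have "\<dots> \<in> Y \<longleftrightarrow> Q t" unfolding Q_def using mem_Y_iff[OF assms(1) that(2) b'] by simp
      finally show ?thesis .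
    qed
    thus ?thesis unfolding S_def by simp
  qed
  \<comment> \<open>\<open>x\<close> and \<open>x'\<close> reach the same classes modulo
    \<open>g2\<close>, namely all of \<open>cls Y\<close>.\<close>
  have "\<exists>y'\<in>X. \<exists>s. a * y' - b * x' = a * y - b * x + g2 * s" if "y \<in> X" for y
  proof -
    have "(a * y - b * x) mod g2 \<in> reach x'"
      using that reach_eq[OF assms(1)] reach_eq[OF assms(2)] unfolding reach_def by blast
    then obtain y' where "y' \<in> X" "(a * y' - b * x') mod g2 = (a * y - b * x) mod g2"
      unfolding reach_def by auto
    hence "[a * y - b * x = a * y' - b * x'] (mod g2)" by (simp add: cong_def)
    thus ?thesis using \<open>y' \<in> X\<close> by (auto simp: cong_iff_lin)
  qed
  then obtain nxt sh where nxt: "\<And>y. y \<in> X \<Longrightarrow> nxt y \<in> X"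
    and sh: "\<And>y. y \<in> X \<Longrightarrow> a * nxt y - b * x' = a * y - b * x + g2 * sh y" by metis
  have Q': "x' - g2 * (b' * t) \<in> X \<longleftrightarrow> Q (sh y + t)" if "y \<in> X" for y t
  proof -
    have "x' - g2 * (b' * t) \<in> X \<longleftrightarrow> a * nxt y - b * x' + g2 * t \<in> Y"
      using mem_Y_iff[OF assms(2) nxt[OF that] b'] by simp
    also have "a * nxt y - b * x' + g2 * t = a * y - b * x + g2 * (sh y + t)"
      using sh[OF that] by (simp add: algebra_simps)
    also have "\<dots> \<in> Y \<longleftrightarrow> Q (sh y + t)" unfolding Q_def using mem_Y_iff[OF assms(1) that b'] by simp
    finally show ?thesis .
  qed
  \<comment> \<open>The left side of \<open>Q'\<close> is the same for all \<open>y\<close>, so any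
    two shifts agree modulo the stabiliser.\<close>
  have S_sh: "sh y - sh x \<in> S" if "y \<in> X" for y
  proof -
    have "Q (t + (sh y - sh x)) \<longleftrightarrow> Q t" for t
    proof -
      have "sh y + (t - sh x) = t + (sh y - sh x)" "sh x + (t - sh x) = t" by simp_all
      from Q'[OF that, of "t - sh x", unfolded this] Q'[OF assms(1), of "t - sh x", unfolded this]
      show ?thesis by blast
    qed
    thus ?thesis unfolding S_def by simp
  qed
  \<comment> \<open>Each application of \<open>nxt\<close> adds \<open>b * (x' - x)\<close> to
    \<open>a * y\<close> modulo \<open>g2\<close>, so after \<open>g2\<close> applications the orbit
    is back in the class of \<open>x\<close>.\<close>
  define ys where "ys i = (nxt ^^ i) x" for i
  have ys: "ys i \<in> X" for i unfolding ys_def by (induction i) (use assms(1) nxt in auto)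
  have sum: "a * ys n = a * x + int n * (b * (x' - x)) + g2 * (\<Sum>i<n. sh (ys i))" for n
  proof (induction n)
    case (Suc n)
    have "a * ys (Suc n) = a * ys n + b * (x' - x) + g2 * sh (ys n)"
      using sh[OF ys[of n]] by (simp add: ys_def algebra_simps)
    thus ?case using Suc by (simp add: algebra_simps)
  qed (simp add: ys_def)
  have S_sum: "(\<Sum>i<n. sh (ys i)) - int n * sh x \<in> S" for n
  proof (induction n)
    case (Suc n)
    have "((\<Sum>i<n. sh (ys i)) - int n * sh x) + (sh (ys n) - sh x) \<in> S" using S_add Suc S_sh[OF ys] by blast
    thus ?case by (simp add: algebra_simps)
  qed (simp add: S_0)
  define n where "n = nat g2"
  have n: "int n = g2" using pos(2) unfolding n_def by simp
  have "g2 dvd a * (ys n - x)"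
    using sum[of n] by (simp add: n right_diff_distrib)
  hence "g2 dvd ys n - x" using cop(3) by (simp add: coprime_dvd_mult_right_iff coprime_commute)
  then obtain w where w: "ys n = x + g2 * w" by (metis add.commute diff_add_cancel dvdE)
  have "g2 * (a * w) = g2 * (b * (x' - x) + (\<Sum>i<n. sh (ys i)))"
    using sum[of n] by (simp add: n w algebra_simps)
  hence "a * w = b * (x' - x) + (\<Sum>i<n. sh (ys i))" using pos(2) by simp
  moreover have "a * w \<in> S" using S_fibre[OF assms(1)] ys[of n] w by simp
  \<comment> \<open>Around the cycle the shifts sum to \<open>g2 * sh x\<close> modulo
    \<open>S\<close>. Multiplying by the inverse \<open>c\<close> of \<open>g2\<close> modulo
    \<open>g1\<close> then isolates \<open>sh x\<close>.\<close>
  ultimately have "b * (x' - x) + g2 * sh x \<in> S"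
    using S_diff[OF _ S_sum[of n], of "a * w"] by (simp add: n)
  hence "c * (b * (x' - x) + g2 * sh x) \<in> S" by (rule S_mult)
  moreover have "[c * (b * (x' - x) + g2 * sh x) = sh x + b * c * (x' - x)] (mod g1)"
  proof -
    have "c * (b * (x' - x) + g2 * sh x) = (g2 * c) * sh x + b * c * (x' - x)" by (simp add: algebra_simps)
    also have "[\<dots> = 1 * sh x + b * c * (x' - x)] (mod g1)" using c by (intro cong_add cong_mult cong_refl)
    finally show ?thesis by simp
  qed
  ultimately have "sh x + b * c * (x' - x) \<in> S" by (rule S_cong)
  moreover have "Q 0" unfolding Q_def using assms(1) by simp
  ultimately have "Q (0 + (sh x + b * c * (x' - x)))" unfolding S_def by blast
  \<comment> \<open>This is the required corner: it differs from \<open>x'\<close> by a multiple of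
    \<open>g2\<close>, and modulo \<open>g1\<close> the factors \<open>b * b'\<close> and
    \<open>g2 * c\<close> cancel, leaving \<open>x\<close>.\<close>
  hence "x' - g2 * (b' * (b * c * (x' - x))) \<in> X" using Q'[OF assms(1)] by simp
  moreover have "[x' - g2 * (b' * (b * c * (x' - x))) = x] (mod g1)"
  proof -
    have "x' - g2 * (b' * (b * c * (x' - x))) = x' - (b * b') * (g2 * c) * (x' - x)" by simp
    also have "[\<dots> = x' - 1 * 1 * (x' - x)] (mod g1)" using b' c by (intro cong_diff cong_mult cong_refl)
    finally show ?thesis by simp
  qed
  moreover have "[x' - g2 * (b' * (b * c * (x' - x))) = x'] (mod g2)" by (simp add: cong_iff_dvd_diff)
  ultimately show ?thesis by blast
qed

text \<open>In components modulo \<open>g1\<close> and \<open>g2\<close>, take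
  \<open>p = (x, x0)\<close> and \<open>p' = (x0, x)\<close>, both available by
  \<open>rectangle\<close>. Then \<open>a * p' - b * p\<close> is
  \<open>(- b * x + a * x0, a * x - b * x0)\<close>, an affine function of \<open>x\<close> with
  unit multiplier \<open>(- b, a)\<close>. Its image lies in \<open>Y\<close> and has as many
  classes.\<close>

lemma lin_op_eq_affine_image: "\<exists>u t. coprime u (g1 * g2) \<and> Y = affine_image (g1 * g2) u t X"
proof -
  obtain x0 where x0: "x0 \<in> X" using ne by blast
  obtain u where u: "[u = - b] (mod g1)" "[u = a] (mod g2)"
    using binary_chinese_remainder_int[OF cop(1)] by blast
  obtain t where t: "[t = a * x0] (mod g1)" "[t = - b * x0] (mod g2)"
    using binary_chinese_remainder_int[OF cop(1)] by blast
  have "coprime u g1" using cong_imp_coprime[OF cong_sym[OF u(1)]] cop(2) by simp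
  moreover have "coprime u g2" using cong_imp_coprime[OF cong_sym[OF u(2)] cop(3)] .
  ultimately have u_unit: "coprime u (g1 * g2)" by simp
  have "affine_image (g1 * g2) u t X \<subseteq> Y"
  proof
    fix z assume "z \<in> affine_image (g1 * g2) u t X"
    then obtain x where x: "x \<in> X" "[z = u * x + t] (mod g1 * g2)" unfolding affine_image_def by auto
    obtain p where p: "p \<in> X" "[p = x] (mod g1)" "[p = x0] (mod g2)" using rectangle[OF x(1) x0] by blast
    obtain p' where p': "p' \<in> X" "[p' = x0] (mod g1)" "[p' = x] (mod g2)" using rectangle[OF x0 x(1)] by blast
    have "[a * p' - b * p = u * x + t] (mod g1)"
    proof -
      have "[a * p' - b * p = a * x0 - b * x] (mod g1)" using p p' by (intro cong_diff cong_mult cong_refl)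
      also have "a * x0 - b * x = - b * x + a * x0" by simp
      also have "[\<dots> = u * x + t] (mod g1)"
        using cong_sym[OF u(1)] cong_sym[OF t(1)] by (intro cong_add cong_mult cong_refl)
      finally show ?thesis .
    qed
    moreover have "[a * p' - b * p = u * x + t] (mod g2)"
    proof -
      have "[a * p' - b * p = a * x - b * x0] (mod g2)" using p p' by (intro cong_diff cong_mult cong_refl)
      also have "a * x - b * x0 = a * x + - b * x0" by simp
      also have "[\<dots> = u * x + t] (mod g2)"
        using cong_sym[OF u(2)] cong_sym[OF t(2)] by (intro cong_add cong_mult cong_refl)
      finally show ?thesis .
    qed
    ultimately have "[a * p' - b * p = u * x + t] (mod g1 * g2)"
      using cop(1) by (rule coprime_cong_mult)
    hence "[a * p' - b * p = z] (mod g1 * g2)" using cong_sym[OF x(2)] by (rule cong_trans)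
    thus "z \<in> Y" using fully_periodic_cong[OF per_Y Y_I[OF p(1) p'(1)]] by blast
  qed
  hence "affine_image (g1 * g2) u t X = Y"
    using pos ncls_affine_image[of "g1 * g2" u t X] u_unit eq
    by (intro ncls_le_imp_eq[of "g1 * g2"] fully_periodic_affine_image) auto
  thus ?thesis using u_unit by blast
qed

end

end

lemma lin_op_monotone_ncls:
  assumes "0 < g" "coprime a b" "fully_periodic g X" "X \<noteq> {}"
  shows "ncls g X \<le> ncls g (lin_op a b X)"
    and "ncls g (lin_op a b X) = ncls g X \<Longrightarrow> \<exists>u t. coprime u g \<and> lin_op a b X = affine_image g u t X"
proof -
  obtain g1 g2 where g: "0 < g1" "0 < g2" "g = g1 * g2" "coprime g1 g2" "coprime b g1" "coprime a g2"
    using coprime_splitting[OF assms(1,2)] by blast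
  then interpret split_op g1 g2 a b X using assms by unfold_locales auto
  show "ncls g X \<le> ncls g (lin_op a b X)"
    using ncls_lin_op_ge unfolding g(3) Y_def .
  show "ncls g (lin_op a b X) = ncls g X \<Longrightarrow> \<exists>u t. coprime u g \<and> lin_op a b X = affine_image g u t X"
    using lin_op_eq_affine_image unfolding g(3) Y_def .
qed

section \<open>Counting the iterates from index \<open>K\<close> on\<close>

lemma card_lin_iter_le:
  fixes g :: nat
  assumes g: "0 < g" and cop: "\<And>j. j \<ge> 1 \<Longrightarrow> coprime (a j) (b j)"
    and per: "\<And>k. k \<ge> K \<Longrightarrow> fully_periodic (int g) (lin_iter a b k A)" and ne: "A \<noteq> {}"
  shows "finite {lin_iter a b k A | k. k \<ge> K}" "card {lin_iter a b k A | k. k \<ge> K} \<le> g ^ 3"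
proof -
  define X where "X k = lin_iter a b k A" for k
  define N where "N k = ncls (int g) (X k)" for k
  have X_Suc: "X (Suc k) = lin_op (a (Suc k)) (b (Suc k)) (X k)" for k unfolding X_def by simp
  have X_ne: "X k \<noteq> {}" for k
    by (induction k) (use ne in \<open>auto simp: X_def lin_op_def\<close>)
  have N_Suc: "N k \<le> N (Suc k)" if "k \<ge> K" for k
    using lin_op_monotone_ncls(1)[of "int g" "a (Suc k)" "b (Suc k)" "X k"] g cop[of "Suc k"] X_ne[of k]
      per[OF that] unfolding N_def X_Suc by (simp add: X_def)
  have N_mono: "N i \<le> N j" if "K \<le> i" "i \<le> j" for i j
    using that(2)
  proof (induction j rule: dec_induct)
    case (step j)
    thus ?case using N_Suc[of j] that(1) by simp
  qed simp
  \<comment> \<open>By monotonicity, equal counts at \<open>i\<close> and \<open>j\<close> force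
    equality at each step between them, and the affine maps of these steps compose.\<close>
  have orbit: "\<exists>u t. coprime u (int g) \<and> X j = affine_image (int g) u t (X i)"
    if "K \<le> i" "i \<le> j" "N j = N i" for i j
    using that(2,3)
  proof (induction j rule: dec_induct)
    case base
    have "X i = affine_image (int g) 1 0 (X i)"
      using affine_image_id[of "int g" "X i"] per[OF that(1)] unfolding X_def by simp
    thus ?case using coprime_1_left by blast
  next
    case (step j)
    have "K \<le> j" using that(1) step.hyps by simp
    have "N j = N i" "N (Suc j) = N j"
      using N_mono[of i j] N_Suc[OF \<open>K \<le> j\<close>] step.prems step.hyps that(1) by auto
    from step.IH[OF this(1)] obtain u t where ut: "coprime u (int g)" "X j = affine_image (int g) u t (X i)"
      by blast
    obtain v s where vs: "coprime v (int g)" "X (Suc j) = affine_image (int g) v s (X j)"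
      using lin_op_monotone_ncls(2)[of "int g" "a (Suc j)" "b (Suc j)" "X j"] g cop[of "Suc j"] X_ne[of j]
        per[OF \<open>K \<le> j\<close>] \<open>N (Suc j) = N j\<close> unfolding N_def X_Suc[symmetric] by (auto simp: X_def)
    have "X (Suc j) = affine_image (int g) (v * u) (v * t + s) (X i)"
      unfolding vs(2) ut(2) by (rule affine_image_affine_image)
    moreover have "coprime (v * u) (int g)" using ut(1) vs(1) by simp
    ultimately show ?case by blast
  qed
  \<comment> \<open>The first set with \<open>n\<close> classes represents all others with that
    count. For values \<open>n\<close> that do not occur \<open>first n\<close> is arbitrary, which
    is harmless for an upper bound.\<close>
  define first where "first n = (LEAST k. K \<le> k \<and> N k = n)" for n
  define F where "F = (\<lambda>(n, u, t). affine_image (int g) u t (X (first n)))"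
  define D where "D = {1..g} \<times> {0..<int g} \<times> {0..<int g}"
  have "{X k | k. k \<ge> K} \<subseteq> F ` D"
  proof
    fix Z assume "Z \<in> {X k | k. k \<ge> K}"
    then obtain k where k: "K \<le> k" "Z = X k" by auto
    have fst: "K \<le> first (N k)" "N (first (N k)) = N k" "first (N k) \<le> k"
      using LeastI[of "\<lambda>j. K \<le> j \<and> N j = N k" k] Least_le[of "\<lambda>j. K \<le> j \<and> N j = N k" k] k(1)
      unfolding first_def by auto
    obtain u t where "X k = affine_image (int g) u t (X (first (N k)))"
      using orbit[OF fst(1,3) fst(2)[symmetric]] by blast
    hence "Z = F (N k, u mod int g, t mod int g)" unfolding F_def k(2) by (simp add: affine_image_mod)
    moreover have "(N k, u mod int g, t mod int g) \<in> D"
      using ncls_le[of "int g" "X k"] ncls_pos[of "int g" "X k"] X_ne g unfolding D_def N_def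
      by (auto simp: Suc_le_eq)
    ultimately show "Z \<in> F ` D" by blast
  qed
  moreover have "finite D" "card D = g ^ 3" unfolding D_def by (simp_all add: power3_eq_cube)
  ultimately show "finite {lin_iter a b k A | k. k \<ge> K}" "card {lin_iter a b k A | k. k \<ge> K} \<le> g ^ 3"
    unfolding X_def using finite_surj surj_card_le[of D _ F] by auto
qed

section \<open>Choice of the constant and assembly\<close>

theorem theorem6p1:
  "\<exists>c::real. c > 0 \<and>
     (\<forall>(L::nat) (A::int set) (a::nat \<Rightarrow> int) (b::nat \<Rightarrow> int) (\<beta>::real) (K::nat).
        L \<ge> 2 \<longrightarrow>
        upper_density A > 0 \<longrightarrow>
        \<beta> = 1 / upper_density A \<longrightarrow>
        (\<forall>j\<ge>1. 0 < a j \<and> 0 < b j \<and> a j \<le> int L \<and> b j \<le> int L \<and> gcd (a j) (b j) = 1) \<longrightarrow>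
        K = nat \<lfloor>c * (log 2 \<beta> + real L)\<rfloor> \<longrightarrow>
        (\<exists>g::nat. 0 < g \<and> g \<le> L ^ (K + 1) \<and>
           (\<forall>k\<ge>K. fully_periodic (int g) (lin_iter a b k A)) \<and>
           lin_stable a b (K + g ^ 3 * L ^ 2) A))"
proof (intro exI[of _ "100 :: real"] conjI allI impI)
  fix L K :: nat and A :: "int set" and a b :: "nat \<Rightarrow> int" and \<beta> :: real
  assume L: "L \<ge> 2" and dens: "upper_density A > 0" and \<beta>: "\<beta> = 1 / upper_density A"
    and ab: "\<forall>j\<ge>1. 0 < a j \<and> 0 < b j \<and> a j \<le> int L \<and> b j \<le> int L \<and> gcd (a j) (b j) = 1"
    and K: "K = nat \<lfloor>100 * (log 2 \<beta> + real L)\<rfloor>"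
  have cop: "coprime (a j) (b j)" if "j \<ge> 1" for j using ab that by (simp add: coprime_iff_gcd_eq_1)
  have "1 \<le> \<beta>" using dens upper_density_bounds(2)[of A] unfolding \<beta> by simp
  hence "0 \<le> log 2 \<beta>" by simp
  define l where "l = nat \<lceil>log 2 \<beta>\<rceil>"
  have l: "log 2 \<beta> \<le> real l" "real l \<le> log 2 \<beta> + 1"
    using \<open>0 \<le> log 2 \<beta>\<close> unfolding l_def by linarith+
  have "\<beta> = 2 powr log 2 \<beta>" using \<open>1 \<le> \<beta>\<close> by simp
  also have "\<dots> \<le> 2 powr real l" using l(1) by (intro powr_mono) auto
  finally have \<beta>_le: "1 / upper_density A \<le> 2 ^ l" unfolding \<beta> by (simp add: powr_realpow)
  define k where "k = 32 * (l + L)"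
  obtain g where g: "0 < g" "g \<le> L ^ (k + 2 + l)" "fully_periodic (int g) (lin_iter a b (Suc k) A)"
  proof (rule ex_period[OF L dens \<beta>_le, of a b])
    show "1 \<le> a j \<and> a j \<le> int L \<and> 1 \<le> b j \<and> b j \<le> int L" if "j \<ge> 1" for j
      using ab that by force
  qed (simp add: k_def)
  \<comment> \<open>The left side is \<open>33 * l + 32 * L + 1\<close>, where \<open>l\<close>
    exceeds \<open>log 2 \<beta>\<close> by at most 1; the constant 100 absorbs the extra 34 as
    \<open>L \<ge> 2\<close>. The inequality gives both \<open>Suc k \<le> K\<close> for periodicity
    and \<open>k + 2 + l \<le> K + 1\<close> for the size of \<open>g\<close>.\<close>
  have "k + 1 + l \<le> K"
  proof -
    have "real (k + 1 + l) \<le> 100 * (log 2 \<beta> + real L)"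
      using l \<open>0 \<le> log 2 \<beta>\<close> L unfolding k_def by simp
    hence "int (k + 1 + l) \<le> \<lfloor>100 * (log 2 \<beta> + real L)\<rfloor>" unfolding le_floor_iff by simp
    thus ?thesis unfolding K by linarith
  qed
  have per: "fully_periodic (int g) (lin_iter a b j A)" if "Suc k \<le> j" for j
    using that
  proof (induction j rule: dec_induct)
    case (step j)
    thus ?case using fully_periodic_lin_op[OF _ cop[of "Suc j"]] by simp
  qed (rule g(3))
  have "A \<noteq> {}" using ex_small_difference[OF dens] unfolding diffs_def by blast
  define late where "late = {lin_iter a b j A | j. j \<ge> K}"
  have late: "finite late" "card late \<le> g ^ 3"
  proof -
    have "fully_periodic (int g) (lin_iter a b j A)" if "j \<ge> K" for j
      using per that \<open>k + 1 + l \<le> K\<close> by simp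
    note * = card_lin_iter_le[OF g(1) cop this \<open>A \<noteq> {}\<close>]
    show "finite late" "card late \<le> g ^ 3" unfolding late_def using * by blast+
  qed
  define early where "early = (\<lambda>j. lin_iter a b j A) ` {..<K}"
  have early: "finite early" "card early \<le> K"
    using card_image_le[of "{..<K}" "\<lambda>j. lin_iter a b j A"] unfolding early_def by auto
  \<comment> \<open>\<open>A\<close> is the iterate of index 0, so it is covered like all the
    others.\<close>
  have "{A} \<union> {lin_iter a b j A | j. j \<ge> 1} \<subseteq> early \<union> late"
  proof -
    have "lin_iter a b j A \<in> early \<union> late" for j
      unfolding early_def late_def by (cases "j < K") auto
    from this[of 0] this show ?thesis by auto
  qed
  moreover have "card (early \<union> late) \<le> K + g ^ 3 * L ^ 2"
  proof -
    have "card (early \<union> late) \<le> K + g ^ 3" using card_Un_le[of early late] early late by simp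
    also have "g ^ 3 \<le> g ^ 3 * L ^ 2" using L by simp
    finally show ?thesis by simp
  qed
  moreover have "finite (early \<union> late)" using early(1) late(1) by simp
  ultimately have stable: "lin_stable a b (K + g ^ 3 * L ^ 2) A"
    unfolding lin_stable_def using card_mono[of "early \<union> late"] finite_subset[of _ "early \<union> late"]
    by (meson le_trans)
  have "L ^ (k + 2 + l) \<le> L ^ (K + 1)" using L \<open>k + 1 + l \<le> K\<close> by (intro power_increasing) auto
  with g(2) have "g \<le> L ^ (K + 1)" by (rule le_trans)
  thus "\<exists>g::nat. 0 < g \<and> g \<le> L ^ (K + 1) \<and>
           (\<forall>k\<ge>K. fully_periodic (int g) (lin_iter a b k A)) \<and>
           lin_stable a b (K + g ^ 3 * L ^ 2) A"
    using g(1) per \<open>k + 1 + l \<le> K\<close> stable by (intro exI[of _ g]) auto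
qed simp

end
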